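(* Let $a\in C^1([-1,1])$ with $a>0$ on $(-1,1)$ and $a(-1)=a(1)=0$, and let $\xi_a(x)=\int_0^x\frac{ds}{a(s)}$. Let $T>0$ and $Q_T=(0,T)\times(-1,1)$. If $\xi_a\in L^{\frac{p}{2-p}}(-1,1)$ for some $p\in[1,2)$, then $$L^2(0,T;H^1_a(-1,1))\cap L^\infty(0,T;L^2(-1,1))\subset L^{2p}(Q_T),$$ and there is a positive constant $c$ such that for all $u$ in the space on the left $$\|u\|_{L^{2p}(Q_T)}\le c\,T^{\frac1{2p}\left(1-\frac p2\right)}\|u\|_{\mathcal B(Q_T)} .$$
   Context: $H^1_a(-1,1)=\{u\in L^2(-1,1): u$ is locally absolutely continuous in $(-1,1)$ and $\sqrt a\,u_x\in L^2(-1,1)\}$, with norm $\|u\|_{1,a}^2=\|u\|_{L^2(-1,1)}^2+\|\sqrt a\,u_x\|_{L^2(-1,1)}^2$. The norm $\|\cdot\|_{\mathcal B(Q_T)}$ is given by $\|u\|_{\mathcal B(Q_T)}^2=\sup_{t\in[0,T]}\|u(t,\cdot)\|_{L^2(-1,1)}^2+2\int_0^T\int_{-1}^1a(x)u_x^2\,dx\,dt$ (essential supremum when $u$ is only in $L^\infty(0,T;L^2(-1,1))$). The constant $c$ is chosen after $T$, $a$ and $p$ are fixed, and does not depend on $u$. *)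

theory Defs
  imports "HOL-Probability.Essential_Supremum"
begin

section \<open>Lebesgue spaces of real functions\<close>

text \<open>Elements are functions, not classes; \<open>Lp_norm\<close> is the corresponding seminorm, meaningful
  for \<open>0 < p < \<infinity>\<close> on members of \<open>Lp_space\<close>.\<close>

definition Lp_space :: "'a measure \<Rightarrow> real \<Rightarrow> ('a \<Rightarrow> real) set" where
  "Lp_space M p = {f \<in> borel_measurable M. integrable M (\<lambda>x. \<bar>f x\<bar> powr p)}"

definition Lp_norm :: "'a measure \<Rightarrow> real \<Rightarrow> ('a \<Rightarrow> real) \<Rightarrow> real" where
  "Lp_norm M p f = (\<integral>x. \<bar>f x\<bar> powr p \<partial>M) powr (1 / p)"

section \<open>Bochner spaces\<close>

text \<open>A (semi)normed space of real functions is given by its set \<open>V\<close> of members and its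
  seminorm \<open>N\<close>. Strong measurability asks for \<open>V\<close>-valued simple functions converging
  to \<open>u\<close> in \<open>N\<close> almost everywhere. The values of \<open>u\<close> are required to lie in \<open>V\<close> for almost every
  \<open>t\<close> only. Simple functions are not required to vanish outside a set of finite measure, so this
  is the usual notion for finite \<open>M\<close>.\<close>

definition bochner_measurable ::
  "'t measure \<Rightarrow> ('x \<Rightarrow> real) set \<Rightarrow> (('x \<Rightarrow> real) \<Rightarrow> real) \<Rightarrow> ('t \<Rightarrow> 'x \<Rightarrow> real) \<Rightarrow> bool" where
  "bochner_measurable M V N u \<longleftrightarrow>
     (AE t in M. u t \<in> V) \<and>
     (\<exists>s :: nat \<Rightarrow> 't \<Rightarrow> 'x \<Rightarrow> real.
        (\<forall>n. simple_function M (s n)) \<and> (\<forall>n. \<forall>t\<in>space M. s n t \<in> V) \<and>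
        (AE t in M. (\<lambda>n. N (\<lambda>x. s n t x - u t x)) \<longlonglongrightarrow> 0))"

definition bochner_Lp ::
  "'t measure \<Rightarrow> real \<Rightarrow> ('x \<Rightarrow> real) set \<Rightarrow> (('x \<Rightarrow> real) \<Rightarrow> real) \<Rightarrow> ('t \<Rightarrow> 'x \<Rightarrow> real) set" where
  "bochner_Lp M p V N = {u. bochner_measurable M V N u \<and> (\<lambda>t. N (u t)) \<in> Lp_space M p}"

definition bochner_Linf ::
  "'t measure \<Rightarrow> ('x \<Rightarrow> real) set \<Rightarrow> (('x \<Rightarrow> real) \<Rightarrow> real) \<Rightarrow> ('t \<Rightarrow> 'x \<Rightarrow> real) set" where
  "bochner_Linf M V N = {u. bochner_measurable M V N u \<and> (\<exists>C. AE t in M. N (u t) \<le> C)}"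

section \<open>Absolute continuity and \<open>C\<^sup>1\<close> functions on an interval\<close>

text \<open>Finite families of non-overlapping subintervals are encoded as finite sets of pairs
  of end points.\<close>

definition abs_continuous_on :: "real \<Rightarrow> real \<Rightarrow> (real \<Rightarrow> real) \<Rightarrow> bool" where
  "abs_continuous_on c d f \<longleftrightarrow>
     (\<forall>\<epsilon>>0. \<exists>\<delta>>0. \<forall>D :: (real \<times> real) set.
        finite D \<and> (\<forall>(x, y)\<in>D. c \<le> x \<and> x \<le> y \<and> y \<le> d) \<and>
        disjoint_family_on (\<lambda>(x, y). {x<..<y}) D \<and> (\<Sum>(x, y)\<in>D. y - x) < \<delta>
        \<longrightarrow> (\<Sum>(x, y)\<in>D. \<bar>f y - f x\<bar>) < \<epsilon>)"

definition locally_abs_continuous_on :: "real set \<Rightarrow> (real \<Rightarrow> real) \<Rightarrow> bool" where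
  "locally_abs_continuous_on S f \<longleftrightarrow>
     (\<forall>c d. c \<le> d \<and> {c..d} \<subseteq> S \<longrightarrow> abs_continuous_on c d f)"

text \<open>One-sided derivatives at the end points, unlike \<open>C1_differentiable_on\<close>.\<close>

definition C1_on_Icc :: "real \<Rightarrow> real \<Rightarrow> (real \<Rightarrow> real) \<Rightarrow> bool" where
  "C1_on_Icc c d f \<longleftrightarrow>
     (\<exists>f'. continuous_on {c..d} f' \<and>
        (\<forall>x\<in>{c..d}. (f has_real_derivative f' x) (at x within {c..d})))"

section \<open>The weighted spaces\<close>

abbreviation I_meas :: "real measure" where
  "I_meas \<equiv> lebesgue_on {-1<..<1}"

abbreviation time_meas :: "real \<Rightarrow> real measure" where
  "time_meas T \<equiv> lebesgue_on {0<..<T}"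

abbreviation Q_meas :: "real \<Rightarrow> (real \<times> real) measure" where
  "Q_meas T \<equiv> lebesgue_on ({0<..<T} \<times> {-1<..<1})"

text \<open>The interval integral is signed, so \<open>\<xi>\<close> is negative to the left of \<open>0\<close>.\<close>

definition xi :: "(real \<Rightarrow> real) \<Rightarrow> real \<Rightarrow> real" where
  "xi a x = (LBINT s=0..x. 1 / a s)"

text \<open>Members are the locally absolutely continuous representatives, and \<open>u\<^sub>x\<close> is the classical
  derivative, which exists almost everywhere. (By Lebesgue's theorem this existence follows from
  local absolute continuity; it is recorded to make \<open>deriv u\<close> meaningful.)\<close>

definition H1 :: "(real \<Rightarrow> real) \<Rightarrow> (real \<Rightarrow> real) set" where
  "H1 a = {u. u \<in> Lp_space I_meas 2 \<and> locally_abs_continuous_on {-1<..<1} u \<and>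
              (AE x in I_meas. u field_differentiable at x) \<and>
              (\<lambda>x. sqrt (a x) * deriv u x) \<in> Lp_space I_meas 2}"

definition H1_norm :: "(real \<Rightarrow> real) \<Rightarrow> (real \<Rightarrow> real) \<Rightarrow> real" where
  "H1_norm a u =
     sqrt ((Lp_norm I_meas 2 u)\<^sup>2 + (Lp_norm I_meas 2 (\<lambda>x. sqrt (a x) * deriv u x))\<^sup>2)"

text \<open>Since members of \<open>H1 a\<close> are continuous on \<open>(-1,1)\<close>, an element of the space below
  determines the function \<open>(t, x) \<mapsto> u t x\<close> on \<open>Q\<^sub>T\<close> up to a null set.\<close>

definition energy_space :: "(real \<Rightarrow> real) \<Rightarrow> real \<Rightarrow> (real \<Rightarrow> real \<Rightarrow> real) set" where
  "energy_space a T =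
     bochner_Lp (time_meas T) 2 (H1 a) (H1_norm a) \<inter>
     bochner_Linf (time_meas T) (Lp_space I_meas 2) (Lp_norm I_meas 2)"

text \<open>On \<open>energy_space\<close> the essential supremum is finite, so \<open>enn2real\<close> loses nothing.\<close>

definition B_norm :: "(real \<Rightarrow> real) \<Rightarrow> real \<Rightarrow> (real \<Rightarrow> real \<Rightarrow> real) \<Rightarrow> real" where
  "B_norm a T u =
     sqrt (enn2real (esssup (time_meas T) (\<lambda>t. ennreal ((Lp_norm I_meas 2 (u t))\<^sup>2))) +
           2 * (\<integral>t. (\<integral>x. a x * (deriv (u t) x)\<^sup>2 \<partial>I_meas) \<partial>time_meas T))"

end

theory Submission
  imports Defs
begin

text \<open>Cauchy--Schwarz applied to \<open>v x - v 0 = \<integral>\<^sub>0\<^sup>x v'\<close> gives \<open>\<bar>v x - v 0\<bar>\<^sup>2 \<le> \<bar>\<xi> x\<bar> \<parallel>\<surd>a v'\<parallel>\<^sup>2\<close>, and averaging over \<open>x\<close>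
  removes \<open>v 0\<close>, so that \<open>v\<^sup>2 \<le> \<parallel>v\<parallel>\<^sub>1\<^sub>,\<^sub>a\<^sup>2 w\<close> pointwise with \<open>w = 2 (1 + \<parallel>\<xi>\<parallel>\<^sub>1) + 2 \<bar>\<xi>\<bar>\<close>, a function in
  \<open>L\<^sup>q\<close> for \<open>q = p / (2 - p)\<close>. Writing \<open>\<bar>v\<bar>\<^sup>2\<^sup>p = \<bar>v\<bar>\<^sup>p \<bar>v\<bar>\<^sup>p\<close>, bounding one factor by \<open>w\<close> and applying Hoelder's
  inequality with exponents \<open>2/p\<close> and \<open>2/(2-p)\<close> yields
  \<open>\<integral> \<bar>v\<bar>\<^sup>2\<^sup>p \<le> C \<parallel>v\<parallel>\<^sub>1\<^sub>,\<^sub>a\<^sup>p \<parallel>v\<parallel>\<^sub>2\<^sup>p\<close>. In time, the last factor is controlled by the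
  essential supremum, and Hoelder's inequality for the first one produces the power of \<open>T\<close>. The pointwise
  bound also turns convergence in \<open>H\<^sup>1\<^sub>a\<close> into convergence at every point, whence the joint
  measurability of \<open>u\<close>.\<close>

section \<open>Absolutely continuous functions\<close>

lemma abs_continuous_on_diff:
  assumes "abs_continuous_on c d f" and "abs_continuous_on c d g"
  shows "abs_continuous_on c d (\<lambda>x. f x - g x)"
  unfolding abs_continuous_on_def
proof (intro allI impI)
  fix e :: real assume "e > 0"
  then have e2: "e / 2 > 0" by simp
  obtain \<delta>1 where d1: "\<delta>1 > 0" "\<And>D :: (real \<times> real) set. finite D \<and> (\<forall>(x, y)\<in>D. c \<le> x \<and> x \<le> y \<and> y \<le> d) \<and>
        disjoint_family_on (\<lambda>(x, y). {x<..<y}) D \<and> (\<Sum>(x, y)\<in>D. y - x) < \<delta>1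
        \<Longrightarrow> (\<Sum>(x, y)\<in>D. \<bar>f y - f x\<bar>) < e / 2"
    using assms(1) e2 unfolding abs_continuous_on_def by meson
  obtain \<delta>2 where d2: "\<delta>2 > 0" "\<And>D :: (real \<times> real) set. finite D \<and> (\<forall>(x, y)\<in>D. c \<le> x \<and> x \<le> y \<and> y \<le> d) \<and>
        disjoint_family_on (\<lambda>(x, y). {x<..<y}) D \<and> (\<Sum>(x, y)\<in>D. y - x) < \<delta>2
        \<Longrightarrow> (\<Sum>(x, y)\<in>D. \<bar>g y - g x\<bar>) < e / 2"
    using assms(2) e2 unfolding abs_continuous_on_def by meson
  show "\<exists>\<delta>>0. \<forall>D :: (real \<times> real) set. finite D \<and> (\<forall>(x, y)\<in>D. c \<le> x \<and> x \<le> y \<and> y \<le> d) \<and>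
        disjoint_family_on (\<lambda>(x, y). {x<..<y}) D \<and> (\<Sum>(x, y)\<in>D. y - x) < \<delta>
        \<longrightarrow> (\<Sum>(x, y)\<in>D. \<bar>f y - g y - (f x - g x)\<bar>) < e"
  proof (intro exI[of _ "min \<delta>1 \<delta>2"] conjI allI impI)
    fix D :: "(real \<times> real) set"
    assume D: "finite D \<and> (\<forall>(x, y)\<in>D. c \<le> x \<and> x \<le> y \<and> y \<le> d) \<and>
        disjoint_family_on (\<lambda>(x, y). {x<..<y}) D \<and> (\<Sum>(x, y)\<in>D. y - x) < min \<delta>1 \<delta>2"
    have "(\<Sum>(x, y)\<in>D. \<bar>f y - g y - (f x - g x)\<bar>)
        \<le> (\<Sum>(x, y)\<in>D. \<bar>f y - f x\<bar>) + (\<Sum>(x, y)\<in>D. \<bar>g y - g x\<bar>)"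
      unfolding sum.distrib[symmetric] by (rule sum_mono) auto
    also have "\<dots> < e / 2 + e / 2"
      by (intro add_strict_mono d1(2) d2(2)) (use D in auto)
    finally show "(\<Sum>(x, y)\<in>D. \<bar>f y - g y - (f x - g x)\<bar>) < e" by simp
  qed (use d1 d2 in auto)
qed

text \<open>One interval is already an admissible family, so the \<open>\<delta>\<close> of absolute
  continuity serves as a modulus of continuity.\<close>

lemma abs_continuous_on_imp_continuous_on:
  assumes "abs_continuous_on c d f"
  shows "continuous_on {c..d} f"
  unfolding continuous_on_iff
proof (intro ballI allI impI)
  fix x e :: real assume x: "x \<in> {c..d}" and "e > 0"
  then obtain \<delta> where d1: "\<delta> > 0" "\<And>D :: (real \<times> real) set. finite D \<and> (\<forall>(x, y)\<in>D. c \<le> x \<and> x \<le> y \<and> y \<le> d) \<and>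
        disjoint_family_on (\<lambda>(x, y). {x<..<y}) D \<and> (\<Sum>(x, y)\<in>D. y - x) < \<delta>
        \<Longrightarrow> (\<Sum>(x, y)\<in>D. \<bar>f y - f x\<bar>) < e"
    using assms unfolding abs_continuous_on_def by meson
  have "dist (f x') (f x) < e" if "x' \<in> {c..d}" "dist x' x < \<delta>" for x'
  proof (cases "x \<le> x'")
    case True
    then show ?thesis
      using d1(2)[of "{(x, x')}"] that x by (auto simp: disjoint_family_on_def dist_real_def)
  next
    case False
    then show ?thesis
      using d1(2)[of "{(x', x)}"] that x
      by (auto simp: disjoint_family_on_def dist_real_def abs_minus_commute)
  qed
  with d1(1) show "\<exists>d'>0. \<forall>x'\<in>{c..d}. dist x' x < d' \<longrightarrow> dist (f x') (f x) < e" by blast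
qed

text \<open>Because the tag \<open>x\<close> lies between \<open>u\<close> and \<open>v\<close>, the
  two one-sided errors \<open>e * (x - u)\<close> and \<open>e * (v - x)\<close> add up to exactly
  \<open>e * (v - u)\<close>. This is the form needed for the cells of a fine tagged
  division.\<close>

lemma has_vector_derivative_straddle:
  fixes f :: "real \<Rightarrow> real"
  assumes "(f has_vector_derivative D) (at x within S)" and "e > 0"
  obtains r where "r > 0"
    and "\<And>u v. u \<in> S \<Longrightarrow> v \<in> S \<Longrightarrow> u \<le> x \<Longrightarrow> x \<le> v \<Longrightarrow> \<bar>u - x\<bar> < r \<Longrightarrow> \<bar>v - x\<bar> < r
           \<Longrightarrow> \<bar>(v - u) * D - (f v - f u)\<bar> \<le> e * (v - u)"
proof -
  obtain r where r: "r > 0" "\<And>y. y \<in> S \<Longrightarrow> \<bar>y - x\<bar> < r \<Longrightarrow> \<bar>f y - f x - (y - x) * D\<bar> \<le> e * \<bar>y - x\<bar>"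
    using assms unfolding has_vector_derivative_def has_derivative_within_alt by fastforce
  show thesis
  proof
    fix u v assume "u \<in> S" "v \<in> S" "u \<le> x" "x \<le> v" "\<bar>u - x\<bar> < r" "\<bar>v - x\<bar> < r"
    then have "\<bar>f u - f x - (u - x) * D\<bar> \<le> e * (x - u)" "\<bar>f v - f x - (v - x) * D\<bar> \<le> e * (v - x)"
      using r(2)[of u] r(2)[of v] by auto
    moreover have "(v - u) * D - (f v - f u) = (f u - f x - (u - x) * D) - (f v - f x - (v - x) * D)"
      by (simp add: algebra_simps)
    moreover have "e * (v - u) = e * (x - u) + e * (v - x)" by (simp add: algebra_simps)
    ultimately show "\<bar>(v - u) * D - (f v - f u)\<bar> \<le> e * (v - u)" by linarith
  qed (fact r)
qed

text \<open>Disjointness turns the total length into the measure of a union inside \<open>U\<close>.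
  Thus an open set of small measure yields families to which absolute continuity applies.\<close>

lemma sum_lengths_le_measure:
  fixes D :: "(real \<times> real) set"
  assumes "finite D" and "\<And>x y. (x, y) \<in> D \<Longrightarrow> x \<le> y \<and> {x<..<y} \<subseteq> U"
    and "disjoint_family_on (\<lambda>(x, y). {x<..<y}) D" and "U \<in> sets lebesgue"
  shows "ennreal (\<Sum>(x, y)\<in>D. y - x) \<le> emeasure lebesgue U"
proof -
  have "ennreal (\<Sum>(x, y)\<in>D. y - x) = (\<Sum>i\<in>D. ennreal (case i of (x, y) \<Rightarrow> y - x))"
    using assms(2) by (intro sum_ennreal[symmetric]) auto
  also have "\<dots> = (\<Sum>i\<in>D. emeasure lebesgue (case i of (x, y) \<Rightarrow> {x<..<y}))"
    using assms(2) by (intro sum.cong) (auto simp: less_imp_le)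
  also have "\<dots> = emeasure lebesgue (\<Union>i\<in>D. case i of (x, y) \<Rightarrow> {x<..<y})"
    using assms(1,3) by (intro sum_emeasure) (auto simp: split_beta')
  also have "\<dots> \<le> emeasure lebesgue U"
    using assms by (intro emeasure_mono) fastforce+
  finally show ?thesis .
qed

text \<open>A gauge proof: the intervals tagged outside the exceptional set are controlled by
  differentiability, and those tagged inside it lie in an open set of small measure, where
  absolute continuity bounds the total variation.\<close>

lemma abs_continuous_on_has_integral:
  fixes f :: "real \<Rightarrow> real"
  assumes "c \<le> d" and ac: "abs_continuous_on c d f" and E: "negligible E"
    and deriv: "\<And>x. x \<in> {c..d} - E \<Longrightarrow> (f has_vector_derivative f' x) (at x within {c..d})"
  shows "(f' has_integral (f d - f c)) {c..d}"
proof -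
  \<comment> \<open>The values of \<open>f'\<close> on the null set \<open>E\<close> are arbitrary.
    With the value 0 there, a cell tagged in \<open>E\<close> contributes only its increment of
    \<open>f\<close>.\<close>
  define g where "g x = (if x \<in> E then 0 else f' x)" for x
  have "(g has_integral (f d - f c)) {c..d}"
    unfolding has_integral_real
  proof (intro allI impI)
    fix e :: real assume "e > 0"
    \<comment> \<open>The summand 1 in the denominator covers \<open>c = d\<close> and makes
      \<open>e' * (d - c) < e / 2\<close> strict.\<close>
    define e' where "e' = e / 2 / (d - c + 1)"
    have e': "e' > 0" "e' * (d - c) < e / 2"
      using \<open>e > 0\<close> \<open>c \<le> d\<close> by (auto simp: e'_def field_simps)
    have "e / 2 > 0" using \<open>e > 0\<close> by simp
    then obtain \<delta> where d1: "\<delta> > 0" "\<And>D :: (real \<times> real) set. finite D \<Longrightarrow> (\<And>x y. (x, y)\<in>D \<Longrightarrow> c \<le> x \<and> x \<le> y \<and> y \<le> d) \<Longrightarrow>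
          disjoint_family_on (\<lambda>(x, y). {x<..<y}) D \<Longrightarrow> (\<Sum>(x, y)\<in>D. y - x) < \<delta>
          \<Longrightarrow> (\<Sum>(x, y)\<in>D. \<bar>f y - f x\<bar>) < e / 2"
      using ac unfolding abs_continuous_on_def by (smt (verit) case_prodI2)
    have Eleb: "E \<in> null_sets lebesgue" using E by (simp add: negligible_iff_null_sets)
    then obtain U where U: "open U" "E \<subseteq> U" "(U - E) \<in> lmeasurable" "emeasure lebesgue (U - E) < ennreal \<delta>"
      using sets_lebesgue_outer_open[of E \<delta>] d1(1) by auto
    have Usmall: "emeasure lebesgue U < ennreal \<delta>"
      using U Eleb emeasure_Diff_null_set[of E lebesgue U] borel_open[OF U(1)] by simp
    \<comment> \<open>Radius of the gauge: inside \<open>U\<close> at exceptional points, small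
      enough for the straddle estimate at the other points of the interval, and 1 where neither
      condition applies.\<close>
    have "\<exists>r>0. (x \<in> E \<longrightarrow> ball x r \<subseteq> U) \<and> (x \<in> {c..d} - E \<longrightarrow> (\<forall>u\<in>{c..d}. \<forall>v\<in>{c..d}. u \<le> x \<and> x \<le> v \<and> \<bar>u - x\<bar> < r \<and> \<bar>v - x\<bar> < r
           \<longrightarrow> \<bar>(v - u) * f' x - (f v - f u)\<bar> \<le> e' * (v - u)))" for x
    proof (cases "x \<in> E")
      case True
      then obtain r where "r > 0" "ball x r \<subseteq> U" using U(2) openE[OF U(1), of x] by blast
      then show ?thesis using True by auto
    next
      case False
      show ?thesis
      proof (cases "x \<in> {c..d}")
        case True
        then obtain r where "r > 0" and "\<And>u v. u \<in> {c..d} \<Longrightarrow> v \<in> {c..d} \<Longrightarrow> u \<le> x \<Longrightarrow> x \<le> v \<Longrightarrow> \<bar>u - x\<bar> < r \<Longrightarrow> \<bar>v - x\<bar> < r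
           \<Longrightarrow> \<bar>(v - u) * f' x - (f v - f u)\<bar> \<le> e' * (v - u)"
          using has_vector_derivative_straddle[OF deriv[of x] e'(1)] False by blast
        then show ?thesis using False by blast
      qed (use False in \<open>auto intro: exI[of _ 1]\<close>)
    qed
    then obtain r where r: "\<And>x. r x > 0" "\<And>x. x \<in> E \<Longrightarrow> ball x (r x) \<subseteq> U"
      "\<And>x u v. x \<in> {c..d} - E \<Longrightarrow> u\<in>{c..d} \<Longrightarrow> v\<in>{c..d} \<Longrightarrow> u \<le> x \<Longrightarrow> x \<le> v \<Longrightarrow> \<bar>u - x\<bar> < r x \<Longrightarrow> \<bar>v - x\<bar> < r x
           \<Longrightarrow> \<bar>(v - u) * f' x - (f v - f u)\<bar> \<le> e' * (v - u)"
      by metis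
    show "\<exists>\<gamma>. gauge \<gamma> \<and> (\<forall>p. p tagged_division_of {c..d} \<and> \<gamma> fine p \<longrightarrow>
        norm ((\<Sum>(x, K)\<in>p. measure lborel K *\<^sub>R g x) - (f d - f c)) < e)"
    proof (intro exI[of _ "\<lambda>x. ball x (r x)"] conjI allI impI)
      show "gauge (\<lambda>x. ball x (r x))" using r(1) by (rule gauge_ball_dependent[rule_format])
      fix p assume "p tagged_division_of {c..d} \<and> (\<lambda>x. ball x (r x)) fine p"
      then have p: "p tagged_division_of {c..d}" and fine: "(\<lambda>x. ball x (r x)) fine p" by auto
      note td = tagged_division_ofD[OF p]
      have cell: "\<exists>u v. K = {u..v} \<and> u \<le> x \<and> x \<le> v \<and> c \<le> u \<and> v \<le> d \<and> {u..v} \<subseteq> ball x (r x)"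
        if xK: "(x, K) \<in> p" for x K
      proof -
        obtain u v where K: "K = cbox u v" using td(4)[OF xK] by auto
        have "K \<subseteq> ball x (r x)" using fine xK by (auto simp: fine_def)
        with K td(2,3)[OF xK] show ?thesis by auto
      qed
      \<comment> \<open>The cells tagged in \<open>E\<close>. Degenerate cells have zero increment
        and are dropped, so that every remaining cell has a nonempty interior.\<close>
      define PE where "PE = {(x, K) \<in> p. x \<in> E \<and> Inf K < Sup K}"
      have finPE: "finite PE" using td(1) by (auto simp: PE_def intro: finite_subset)
      define h where "h = (\<lambda>(x :: real, K :: real set). (Inf K, Sup K))"
      have injP: "K \<noteq> K' \<longrightarrow> {Inf K<..<Sup K} \<inter> {Inf K'<..<Sup K'} = {}"
        "(x, K) \<noteq> (x', K') \<longrightarrow> {Inf K<..<Sup K} \<inter> {Inf K'<..<Sup K'} = {}"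
        if P: "(x, K) \<in> p" "(x', K') \<in> p" for x K x' K'
      proof -
        obtain u v where 1: "K = {u..v}" "u \<le> v" using cell[OF P(1)] by auto
        obtain u' v' where 2: "K' = {u'..v'}" "u' \<le> v'" using cell[OF P(2)] by auto
        show "(x, K) \<noteq> (x', K') \<longrightarrow> {Inf K<..<Sup K} \<inter> {Inf K'<..<Sup K'} = {}"
          using td(5)[OF P] 1 2 by auto
        then show "K \<noteq> K' \<longrightarrow> {Inf K<..<Sup K} \<inter> {Inf K'<..<Sup K'} = {}" by auto
      qed
      \<comment> \<open>Distinct tagged cells have disjoint interiors, so a nonempty interior
        determines the pair. The sum over \<open>PE\<close> can therefore be rewritten over pairs of
        end points, the encoding used by absolute continuity.\<close>
      have inj: "inj_on h PE"
      proof (rule inj_onI)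
        fix z z' assume z: "z \<in> PE" "z' \<in> PE" "h z = h z'"
        obtain x K x' K' where zz: "z = (x, K)" "z' = (x', K')" by (cases z; cases z')
        have "{Inf K<..<Sup K} \<inter> {Inf K'<..<Sup K'} \<noteq> {}"
          using z by (auto simp: zz h_def PE_def)
        then show "z = z'"
          using injP(2)[of x K x' K'] z by (auto simp: zz PE_def)
      qed
      have hPE: "\<exists>x0 K. (x0, K) \<in> p \<and> x0 \<in> E \<and> x = Inf K \<and> y = Sup K \<and> x < y" if "(x, y) \<in> h ` PE" for x y
        using that by (auto simp: h_def PE_def)
      have disj: "disjoint_family_on (\<lambda>(x, y). {x<..<y}) (h ` PE)"
        unfolding disjoint_family_on_def
      proof (intro ballI impI)
        fix m n assume mn: "m \<in> h ` PE" "n \<in> h ` PE" "m \<noteq> n"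
        obtain x K x' K' where zz: "(x, K) \<in> p" "(x', K') \<in> p" "m = (Inf K, Sup K)" "n = (Inf K', Sup K')"
          using mn by (auto simp: h_def PE_def)
        then show "(case m of (x, y) \<Rightarrow> {x<..<y}) \<inter> (case n of (x, y) \<Rightarrow> {x<..<y}) = {}"
          using injP(1)[OF zz(1,2)] mn(3) by auto
      qed
      have bnd: "c \<le> x \<and> x \<le> y \<and> y \<le> d \<and> {x<..<y} \<subseteq> U" if "(x, y) \<in> h ` PE" for x y
      proof -
        obtain x0 K where K: "(x0, K) \<in> p" "x0 \<in> E" "x = Inf K" "y = Sup K" "x < y"
          using hPE[OF \<open>(x, y) \<in> h ` PE\<close>] by blast
        obtain u v where "K = {u..v}" "u \<le> v" "c \<le> u" "v \<le> d" "{u..v} \<subseteq> ball x0 (r x0)"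
          using cell[OF K(1)] by auto
        with r(2)[OF K(2)] K(3,4) greaterThanLessThan_subseteq_atLeastAtMost_iff[of u v u v]
        show ?thesis by (smt (verit) cInf_atLeastAtMost cSup_atLeastAtMost order_trans order_refl)
      qed
      have "ennreal (\<Sum>(x, y)\<in>h ` PE. y - x) \<le> emeasure lebesgue U"
        using finPE bnd disj U by (intro sum_lengths_le_measure) auto
      then have "ennreal (\<Sum>(x, y)\<in>h ` PE. y - x) < ennreal \<delta>" using Usmall by (rule le_less_trans)
      then have "(\<Sum>(x, y)\<in>h ` PE. y - x) < \<delta>"
        by (metis ennreal_less_iff ennreal_leI not_le less_le_not_le)
      then have "(\<Sum>(x, y)\<in>h ` PE. \<bar>f y - f x\<bar>) < e / 2"
        using finPE bnd disj by (intro d1(2)) auto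
      then have PEsum: "(\<Sum>(x, K)\<in>PE. \<bar>f (Sup K) - f (Inf K)\<bar>) < e / 2"
        unfolding sum.reindex[OF inj] by (simp add: h_def split_beta)
      \<comment> \<open>A tag outside \<open>E\<close> falls under the straddle estimate; a tag in
        \<open>E\<close> has \<open>g x = 0\<close>, leaving the increment of \<open>f\<close>. For
        a degenerate cell both sides vanish.\<close>
      have termle: "\<bar>measure lborel K *\<^sub>R g x - (f (Sup K) - f (Inf K))\<bar>
          \<le> e' * (Sup K - Inf K) + (if x \<in> E \<and> Inf K < Sup K then \<bar>f (Sup K) - f (Inf K)\<bar> else 0)"
        if xK: "(x, K) \<in> p" for x K
      proof -
        obtain u v where K: "K = {u..v}" "u \<le> x" "x \<le> v" "c \<le> u" "v \<le> d" "{u..v} \<subseteq> ball x (r x)"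
          using cell[OF xK] by auto
        have uv: "\<bar>u - x\<bar> < r x" "\<bar>v - x\<bar> < r x"
          using K(2,3) subsetD[OF K(6), of u] subsetD[OF K(6), of v] by (auto simp: dist_real_def)
        have "0 \<le> e' * (v - u)" using K e'(1) by simp
        moreover have "\<bar>(v - u) * f' x - (f v - f u)\<bar> \<le> e' * (v - u)" if "x \<notin> E"
          using r(3)[of x u v] that K uv by auto
        ultimately show ?thesis using K by (cases "u = v") (auto simp: g_def)
      qed
      \<comment> \<open>The increments of \<open>f\<close> over the cells telescope to
        \<open>f d - f c\<close>, so the error can be estimated cell by cell.\<close>
      have "(\<Sum>(x, K)\<in>p. measure lborel K *\<^sub>R g x) - (f d - f c)
          = (\<Sum>(x, K)\<in>p. measure lborel K *\<^sub>R g x - (f (Sup K) - f (Inf K)))"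
        using additive_tagged_division_1[OF \<open>c \<le> d\<close> p, of f]
        by (simp add: split_beta sum_subtractf)
      then have "norm ((\<Sum>(x, K)\<in>p. measure lborel K *\<^sub>R g x) - (f d - f c))
          \<le> (\<Sum>(x, K)\<in>p. e' * (Sup K - Inf K) + (if x \<in> E \<and> Inf K < Sup K then \<bar>f (Sup K) - f (Inf K)\<bar> else 0))"
        by (simp only:) (rule sum_norm_le, use termle in auto)
      also have "\<dots> = e' * (\<Sum>(x, K)\<in>p. Sup K - Inf K)
          + (\<Sum>(x, K)\<in>p. if x \<in> E \<and> Inf K < Sup K then \<bar>f (Sup K) - f (Inf K)\<bar> else 0)"
        by (simp add: split_beta sum.distrib sum_distrib_left)
      also have "(\<Sum>(x, K)\<in>p. Sup K - Inf K) = d - c"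
        using additive_tagged_division_1[OF \<open>c \<le> d\<close> p, of "\<lambda>x. x"] by simp
      also have "(\<Sum>(x, K)\<in>p. if x \<in> E \<and> Inf K < Sup K then \<bar>f (Sup K) - f (Inf K)\<bar> else 0)
          = (\<Sum>(x, K)\<in>PE. \<bar>f (Sup K) - f (Inf K)\<bar>)"
        unfolding PE_def by (rule sum.mono_neutral_cong_right) (use td(1) in \<open>auto split: if_splits\<close>)
      finally show "norm ((\<Sum>(x, K)\<in>p. measure lborel K *\<^sub>R g x) - (f d - f c)) < e"
        using PEsum e'(2) by linarith
    qed
  qed
  then show ?thesis
    by (rule has_integral_spike[OF E, rotated]) (auto simp: g_def)
qed

section \<open>Lebesgue spaces\<close>

text \<open>The preimages under \<open>f\<close> and \<open>g\<close> differ by a subset of a null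
  set, and completeness makes such subsets measurable.\<close>

lemma (in complete_measure) borel_measurable_cong_AE:
  assumes f: "f \<in> M \<rightarrow>\<^sub>M N" and ae: "AE x in M. f x = g x"
    and g: "g \<in> space M \<rightarrow> space N"
  shows "g \<in> M \<rightarrow>\<^sub>M N"
proof (rule measurableI)
  fix A assume A: "A \<in> sets N"
  show "g -` A \<inter> space M \<in> sets M"
  proof (rule in_sets_AE)
    show "AE x in M. x \<in> f -` A \<inter> space M \<longleftrightarrow> x \<in> g -` A \<inter> space M"
      using ae by eventually_elim auto
  qed (use f A in auto)
qed (use g in auto)

section \<open>Hoelder's inequality\<close>

lemma weighted_am_gm_powr:
  fixes a b \<theta> :: real
  assumes "0 < \<theta>" "\<theta> < 1" "a \<ge> 0" "b \<ge> 0"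
  shows "a powr \<theta> * b powr (1 - \<theta>) \<le> \<theta> * a + (1 - \<theta>) * b"
proof (cases "a = 0 \<or> b = 0")
  case True
  then show ?thesis using assms by auto
next
  case False
  then show ?thesis using assms by (intro Youngs_inequality_0) auto
qed

text \<open>Hoelder's inequality with exponents \<open>1 / \<theta>\<close> and
  \<open>1 / (1 - \<theta>)\<close>, stated for the integrable functions whose powers are
  multiplied. Weighted AM-GM gives integrability; after division of \<open>f\<close> and
  \<open>g\<close> by their integrals it also gives the sharp constant.\<close>

lemma Holder_interpolation:
  fixes f g :: "'a \<Rightarrow> real"
  assumes \<theta>: "0 < \<theta>" "\<theta> < 1" and f: "integrable M f" and g: "integrable M g"
    and nn: "\<And>x. x \<in> space M \<Longrightarrow> f x \<ge> 0" "\<And>x. x \<in> space M \<Longrightarrow> g x \<ge> 0"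
  shows "integrable M (\<lambda>x. f x powr \<theta> * g x powr (1 - \<theta>))"
    and "(\<integral>x. f x powr \<theta> * g x powr (1 - \<theta>) \<partial>M)
           \<le> (\<integral>x. f x \<partial>M) powr \<theta> * (\<integral>x. g x \<partial>M) powr (1 - \<theta>)"
proof -
  note [measurable] = borel_measurable_integrable[OF f] borel_measurable_integrable[OF g]
  show int: "integrable M (\<lambda>x. f x powr \<theta> * g x powr (1 - \<theta>))"
  proof (rule Bochner_Integration.integrable_bound)
    show "integrable M (\<lambda>x. \<theta> * f x + (1 - \<theta>) * g x)" using f g by auto
    show "AE x in M. norm (f x powr \<theta> * g x powr (1 - \<theta>)) \<le> norm (\<theta> * f x + (1 - \<theta>) * g x)"
    proof (rule AE_I2)
      fix x assume "x \<in> space M"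
      then show "norm (f x powr \<theta> * g x powr (1 - \<theta>)) \<le> norm (\<theta> * f x + (1 - \<theta>) * g x)"
        using weighted_am_gm_powr[OF \<theta> nn] by fastforce
    qed
  qed measurable
  define F where "F = (\<integral>x. f x \<partial>M)"
  define G where "G = (\<integral>x. g x \<partial>M)"
  have F: "F \<ge> 0" and G: "G \<ge> 0"
    unfolding F_def G_def using nn by (auto intro!: Bochner_Integration.integral_nonneg)
  show "(\<integral>x. f x powr \<theta> * g x powr (1 - \<theta>) \<partial>M)
           \<le> (\<integral>x. f x \<partial>M) powr \<theta> * (\<integral>x. g x \<partial>M) powr (1 - \<theta>)"
  \<comment> \<open>Normalisation needs positive integrals. If one integral is zero, that function
    vanishes almost everywhere, and so does the product.\<close>
  proof (cases "F = 0 \<or> G = 0")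
    case True
    then have "(AE x in M. f x = 0) \<or> (AE x in M. g x = 0)"
      unfolding F_def G_def
      using integral_nonneg_eq_0_iff_AE[OF f] integral_nonneg_eq_0_iff_AE[OF g] nn by auto
    then have "AE x in M. f x powr \<theta> * g x powr (1 - \<theta>) = 0"
      by (rule disjE) (auto elim: eventually_mono)
    then have "(\<integral>x. f x powr \<theta> * g x powr (1 - \<theta>) \<partial>M) = 0"
      by (rule integral_eq_zero_AE)
    then show ?thesis by simp
  next
    case False
    then have FG: "F > 0" "G > 0" using F G by auto
    have "(\<integral>x. f x powr \<theta> * g x powr (1 - \<theta>) \<partial>M)
        \<le> (\<integral>x. F powr \<theta> * G powr (1 - \<theta>) * (\<theta> * (f x / F) + (1 - \<theta>) * (g x / G)) \<partial>M)"
    proof (rule integral_mono[OF int])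
      show "integrable M (\<lambda>x. F powr \<theta> * G powr (1 - \<theta>) * (\<theta> * (f x / F) + (1 - \<theta>) * (g x / G)))"
        using f g by auto
      fix x assume x: "x \<in> space M"
      have "f x powr \<theta> * g x powr (1 - \<theta>)
          = F powr \<theta> * G powr (1 - \<theta>) * ((f x / F) powr \<theta> * (g x / G) powr (1 - \<theta>))"
        using nn[OF x] FG by (simp add: powr_divide)
      also have "\<dots> \<le> F powr \<theta> * G powr (1 - \<theta>) * (\<theta> * (f x / F) + (1 - \<theta>) * (g x / G))"
        using nn[OF x] FG by (intro mult_left_mono weighted_am_gm_powr \<theta>) auto
      finally show "f x powr \<theta> * g x powr (1 - \<theta>) \<le> \<dots>" .
    qed
    also have "\<dots> = F powr \<theta> * G powr (1 - \<theta>) * (\<theta> * (F / F) + (1 - \<theta>) * (G / G))"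
      using f g by (simp add: F_def G_def)
    also have "\<dots> = F powr \<theta> * G powr (1 - \<theta>)" using FG by simp
    finally show ?thesis by (simp add: F_def G_def)
  qed
qed

section \<open>Square-integrable functions\<close>

lemma abs_powr_2: "\<bar>x :: real\<bar> powr 2 = x\<^sup>2"
  by (cases "x = 0") (auto simp: powr_numeral)

lemma Lp_space_2_iff:
  "f \<in> Lp_space M 2 \<longleftrightarrow> f \<in> borel_measurable M \<and> integrable M (\<lambda>x. (f x)\<^sup>2)"
  by (simp add: Lp_space_def abs_powr_2)

lemma Lp_norm_2_sq: "(Lp_norm M 2 f)\<^sup>2 = (\<integral>x. (f x)\<^sup>2 \<partial>M)"
proof -
  have "(\<integral>x. (f x)\<^sup>2 \<partial>M) \<ge> 0" by simp
  then show ?thesis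
    by (simp add: Lp_norm_def abs_powr_2 powr_half_sqrt)
qed

lemma Lp_space_2_diff:
  assumes "f \<in> Lp_space M 2" "g \<in> Lp_space M 2"
  shows "(\<lambda>x. f x - g x) \<in> Lp_space M 2"
proof -
  have [measurable]: "f \<in> borel_measurable M" "g \<in> borel_measurable M"
    and int: "integrable M (\<lambda>x. (f x)\<^sup>2)" "integrable M (\<lambda>x. (g x)\<^sup>2)"
    using assms by (auto simp: Lp_space_2_iff)
  have "integrable M (\<lambda>x. (f x - g x)\<^sup>2)"
  proof (rule Bochner_Integration.integrable_bound)
    show "integrable M (\<lambda>x. 2 * (f x)\<^sup>2 + 2 * (g x)\<^sup>2)" using int by auto
    have "(f x - g x)\<^sup>2 \<le> 2 * (f x)\<^sup>2 + 2 * (g x)\<^sup>2" for x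
      using zero_le_power2[of "f x + g x"] by (simp add: power2_eq_square algebra_simps)
    then show "AE x in M. norm ((f x - g x)\<^sup>2) \<le> norm (2 * (f x)\<^sup>2 + 2 * (g x)\<^sup>2)"
      by simp
  qed measurable
  then show ?thesis by (simp add: Lp_space_2_iff)
qed

text \<open>Extension by zero moves the question to \<open>lebesgue\<close>, which is
  complete.\<close>

lemma lebesgue_on_borel_measurable_cong_AE:
  fixes f g :: "'a :: euclidean_space \<Rightarrow> real"
  assumes f: "f \<in> borel_measurable (lebesgue_on S)" and S: "S \<in> sets lebesgue"
    and ae: "AE x in lebesgue_on S. f x = g x"
  shows "g \<in> borel_measurable (lebesgue_on S)"
proof -
  have "(\<lambda>x. f x * indicator S x) \<in> borel_measurable lebesgue"
    using f S by (simp add: borel_measurable_restrict_space_iff mult.commute)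
  moreover have "AE x in lebesgue. f x * indicator S x = g x * indicator S x"
    using ae S by (simp add: AE_restrict_space_iff indicator_def eventually_mono)
  ultimately have "(\<lambda>x. g x * indicator S x) \<in> borel_measurable lebesgue"
    by (rule borel_measurable_AE)
  then show ?thesis
    using S by (simp add: borel_measurable_restrict_space_iff mult.commute)
qed

lemma Lp_space_2_cong_AE:
  fixes f :: "'a :: euclidean_space \<Rightarrow> real"
  assumes f: "f \<in> Lp_space (lebesgue_on S) 2" and S: "S \<in> sets lebesgue"
    and ae: "AE x in lebesgue_on S. f x = g x"
  shows "g \<in> Lp_space (lebesgue_on S) 2"
proof -
  have f': "f \<in> borel_measurable (lebesgue_on S)" "integrable (lebesgue_on S) (\<lambda>x. (f x)\<^sup>2)"
    using f by (auto simp: Lp_space_2_iff)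
  have g: "g \<in> borel_measurable (lebesgue_on S)"
    using f'(1) S ae by (rule lebesgue_on_borel_measurable_cong_AE)
  have "integrable (lebesgue_on S) (\<lambda>x. (g x)\<^sup>2)"
    using f'(2)
  proof (rule Bochner_Integration.integrable_cong_AE_imp)
    show "(\<lambda>x. (g x)\<^sup>2) \<in> borel_measurable (lebesgue_on S)" using g by measurable
    show "AE x in lebesgue_on S. (f x)\<^sup>2 = (g x)\<^sup>2" using ae by (auto elim: eventually_mono)
  qed
  with g show ?thesis by (simp add: Lp_space_2_iff)
qed

section \<open>The weighted Sobolev space\<close>

text \<open>In the bound for \<open>(v x)\<^sup>2\<close>, the constant part accounts for the value
  at 0 and the last term for the increment from 0 to \<open>x\<close>. The form is chosen so that
  the whole squared norm factors out.\<close>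

definition weight :: "(real \<Rightarrow> real) \<Rightarrow> real \<Rightarrow> real" where
  "weight a x = 2 * (1 + (\<integral>s. \<bar>xi a s\<bar> \<partial>I_meas)) + 2 * \<bar>xi a x\<bar>"

lemma weight_ge_2: "weight a x \<ge> 2"
  by (simp add: weight_def)

text \<open>The identity \<open>deriv (u - v) = deriv u - deriv v\<close> is available where both
  functions are differentiable, hence almost everywhere. Square integrability of the weighted
  derivative is therefore transferred along an almost everywhere equality.\<close>

lemma H1_diff:
  assumes u: "u \<in> H1 a" and v: "v \<in> H1 a"
  shows "(\<lambda>x. u x - v x) \<in> H1 a"
proof -
  have ae: "AE x in I_meas. u field_differentiable at x \<and> v field_differentiable at x"
    using u v by (auto simp: H1_def)
  have d: "AE x in I_meas. (\<lambda>x. u x - v x) field_differentiable at x"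
    using ae by eventually_elim (auto intro: field_differentiable_diff)
  have "(\<lambda>x. sqrt (a x) * deriv u x - sqrt (a x) * deriv v x) \<in> Lp_space I_meas 2"
    using u v by (intro Lp_space_2_diff) (auto simp: H1_def)
  moreover have "AE x in I_meas. sqrt (a x) * deriv u x - sqrt (a x) * deriv v x = sqrt (a x) * deriv (\<lambda>x. u x - v x) x"
    using ae by eventually_elim (simp add: right_diff_distrib)
  ultimately have "(\<lambda>x. sqrt (a x) * deriv (\<lambda>x. u x - v x) x) \<in> Lp_space I_meas 2"
    by (rule Lp_space_2_cong_AE[OF _ lmeasurable_box[THEN fmeasurableD, of "-1" "1::real", unfolded box_real]])
  moreover have "(\<lambda>x. u x - v x) \<in> Lp_space I_meas 2"
    using u v by (intro Lp_space_2_diff) (auto simp: H1_def)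
  moreover have "locally_abs_continuous_on {-1<..<1} (\<lambda>x. u x - v x)"
    using u v by (auto simp: H1_def locally_abs_continuous_on_def intro: abs_continuous_on_diff)
  ultimately show ?thesis using d by (simp add: H1_def)
qed

lemma H1_continuous_on:
  assumes "v \<in> H1 a"
  shows "continuous_on {-1<..<1} v"
proof (subst continuous_on_eq_continuous_at, simp, rule ballI)
  fix x :: real assume x: "x \<in> {-1<..<1}"
  \<comment> \<open>The midpoints between \<open>x\<close> and the two end points give a compact
    interval around \<open>x\<close> inside the open one.\<close>
  define c d where "c = (x - 1) / 2" and "d = (x + 1) / 2"
  have cd: "-1 < c" "c < x" "x < d" "d < 1" using x by (auto simp: c_def d_def)
  then have "{c..d} \<subseteq> {-1<..<1}" by auto
  with assms cd have "abs_continuous_on c d v"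
    by (simp add: H1_def locally_abs_continuous_on_def)
  then have "continuous_on {c..d} v" by (rule abs_continuous_on_imp_continuous_on)
  with cd show "isCont v x" by (intro continuous_on_interior) auto
qed

section \<open>Pointwise bounds in the weighted space\<close>

context
  fixes a :: "real \<Rightarrow> real"
  assumes a_cont: "continuous_on {-1<..<1} a" and a_pos: "\<And>x. x \<in> {-1<..<1} \<Longrightarrow> a x > 0"
begin

lemma a_measurable: "a \<in> borel_measurable I_meas"
  using a_cont by (rule continuous_imp_measurable_on_sets_lebesgue) simp

lemma set_integrable_inverse_a:
  assumes "x \<in> {-1<..<1}" "y \<in> {-1<..<1}"
  shows "set_integrable lborel {x..y} (\<lambda>s. 1 / a s)"
proof (rule borel_integrable_atLeastAtMost')
  have "{x..y} \<subseteq> {-1<..<1}" using assms by auto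
  then show "continuous_on {x..y} (\<lambda>s. 1 / a s)"
    using a_pos by (intro continuous_intros continuous_on_subset[OF a_cont]) force+
qed

text \<open>Links the integral against \<open>I_meas\<close>, used for norms and for Hoelder's
  inequality, with the interval integral against \<open>lborel\<close> that defines
  \<open>xi\<close>.\<close>

lemma inverse_a_restrict:
  assumes "x \<in> {-1<..<1}" "y \<in> {-1<..<1}" "x \<le> y"
  shows "integrable I_meas (\<lambda>s. indicator {x..y} s / a s)"
    and "(\<integral>s. indicator {x..y} s / a s \<partial>I_meas) = (LBINT s=x..y. 1 / a s)"
proof -
  have sub: "{x..y} \<subseteq> {-1<..<1}" using assms by auto
  have eq: "indicator {-1<..<1} s *\<^sub>R (indicator {x..y} s / a s) = indicator {x..y} s *\<^sub>R (1 / a s)" for s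
    using sub by (auto simp: indicator_def)
  have int: "integrable lborel (\<lambda>s. indicator {x..y} s *\<^sub>R (1 / a s))"
    using set_integrable_inverse_a[OF assms(1,2)] by (simp add: set_integrable_def)
  show "integrable I_meas (\<lambda>s. indicator {x..y} s / a s)"
    using integrable_completion[OF borel_measurable_integrable[OF int]] int
    by (subst integrable_restrict_space) (simp, simp only: eq)
  have "(\<integral>s. indicator {x..y} s / a s \<partial>I_meas) = (\<integral>s. indicator {x..y} s *\<^sub>R (1 / a s) \<partial>lebesgue)"
    by (subst integral_restrict_space) (simp, simp only: eq)
  also have "\<dots> = (\<integral>s. indicator {x..y} s *\<^sub>R (1 / a s) \<partial>lborel)"
    by (rule integral_completion) (rule borel_measurable_integrable[OF int])
  also have "\<dots> = (LBINT s=x..y. 1 / a s)"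
    using assms(3) by (simp add: interval_integral_Icc set_lebesgue_integral_def)
  finally show "(\<integral>s. indicator {x..y} s / a s \<partial>I_meas) = (LBINT s=x..y. 1 / a s)" .
qed

lemma H1_energy_integrable:
  assumes "v \<in> H1 a"
  shows "integrable I_meas (\<lambda>x. a x * (deriv v x)\<^sup>2)"
    and "(Lp_norm I_meas 2 (\<lambda>x. sqrt (a x) * deriv v x))\<^sup>2 = (\<integral>x. a x * (deriv v x)\<^sup>2 \<partial>I_meas)"
    and "deriv v \<in> borel_measurable I_meas"
proof -
  have sq: "(sqrt (a x) * deriv v x)\<^sup>2 = a x * (deriv v x)\<^sup>2" if "x \<in> {-1<..<1}" for x
    using a_pos[OF that] by (simp add: power_mult_distrib)
  have L: "(\<lambda>x. sqrt (a x) * deriv v x) \<in> Lp_space I_meas 2" using assms by (simp add: H1_def)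
  have "integrable I_meas (\<lambda>x. (sqrt (a x) * deriv v x)\<^sup>2)"
    using L by (simp add: Lp_space_2_iff)
  also have "?this \<longleftrightarrow> integrable I_meas (\<lambda>x. a x * (deriv v x)\<^sup>2)"
    using sq by (intro Bochner_Integration.integrable_cong) auto
  finally show "integrable I_meas (\<lambda>x. a x * (deriv v x)\<^sup>2)" .
  show "(Lp_norm I_meas 2 (\<lambda>x. sqrt (a x) * deriv v x))\<^sup>2 = (\<integral>x. a x * (deriv v x)\<^sup>2 \<partial>I_meas)"
    unfolding Lp_norm_2_sq using sq by (intro Bochner_Integration.integral_cong) auto
  have [measurable]: "(\<lambda>x. sqrt (a x) * deriv v x) \<in> borel_measurable I_meas" "a \<in> borel_measurable I_meas"
    using L a_measurable by (auto simp: Lp_space_def)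
  \<comment> \<open>Division by the positive function \<open>sqrt (a x)\<close> recovers
    measurability of the derivative from that of the weighted derivative.\<close>
  have "(\<lambda>x. (sqrt (a x) * deriv v x) / sqrt (a x)) \<in> borel_measurable I_meas" by measurable
  also have "?this \<longleftrightarrow> deriv v \<in> borel_measurable I_meas"
    using a_pos by (intro measurable_cong) force
  finally show "deriv v \<in> borel_measurable I_meas" .
qed

lemma H1_norm_sq:
  assumes "v \<in> H1 a"
  shows "(H1_norm a v)\<^sup>2 = (\<integral>x. (v x)\<^sup>2 \<partial>I_meas) + (\<integral>x. a x * (deriv v x)\<^sup>2 \<partial>I_meas)"
proof -
  have "(H1_norm a v)\<^sup>2 = (Lp_norm I_meas 2 v)\<^sup>2 + (Lp_norm I_meas 2 (\<lambda>x. sqrt (a x) * deriv v x))\<^sup>2"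
    by (simp add: H1_norm_def)
  then show ?thesis using H1_energy_integrable(2)[OF assms] by (simp add: Lp_norm_2_sq)
qed

text \<open>Absolute continuity makes the increment the integral of the derivative. Cauchy-Schwarz
  for the factors \<open>1 / sqrt (a s)\<close> and \<open>sqrt (a s) * deriv v s\<close> on the
  interval then gives the bound.\<close>

lemma H1_increment_bound:
  assumes v: "v \<in> H1 a" and xy: "x \<in> {-1<..<1}" "y \<in> {-1<..<1}" "x \<le> y"
  shows "(v y - v x)\<^sup>2 \<le> (LBINT s=x..y. 1 / a s) * (\<integral>s. a s * (deriv v s)\<^sup>2 \<partial>I_meas)"
proof -
  have sub: "{x..y} \<subseteq> {-1<..<1}" using xy by auto
  have ac: "abs_continuous_on x y v"
    using v xy sub by (simp add: H1_def locally_abs_continuous_on_def)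
  have "AE s in lebesgue. s \<in> {-1<..<1} \<longrightarrow> v field_differentiable at s"
    using v by (simp add: H1_def AE_restrict_space_iff)
  then obtain E where E: "E \<in> null_sets lebesgue"
    and dE: "\<And>s. s \<in> {-1<..<1} \<Longrightarrow> s \<notin> E \<Longrightarrow> v field_differentiable at s"
    unfolding completion.AE_iff_null_sets by auto
  have FTC: "(deriv v has_integral (v y - v x)) {x..y}"
  proof (rule abs_continuous_on_has_integral[OF xy(3) ac])
    show "negligible E" using E by (simp add: negligible_iff_null_sets)
    fix s assume "s \<in> {x..y} - E"
    then have "v field_differentiable at s" using dE sub by auto
    then have "(v has_real_derivative deriv v s) (at s)" by (simp add: field_differentiable_derivI)
    then show "(v has_vector_derivative deriv v s) (at s within {x..y})"
      by (simp add: has_real_derivative_iff_has_vector_derivative has_vector_derivative_at_within)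
  qed
  define f where "f s = indicator {x..y} s / a s" for s
  define g where "g s = a s * (deriv v s)\<^sup>2" for s
  have f: "integrable I_meas f" "\<And>s. s \<in> space I_meas \<Longrightarrow> f s \<ge> 0"
    and g: "integrable I_meas g" "\<And>s. s \<in> space I_meas \<Longrightarrow> g s \<ge> 0"
    using inverse_a_restrict[OF xy] H1_energy_integrable[OF v] a_pos
    unfolding f_def g_def by (auto simp: less_imp_le)
  have fg: "f s powr (1/2) * g s powr (1 - 1/2) = \<bar>indicator {x..y} s * deriv v s\<bar>"
    if "s \<in> space I_meas" for s
  proof -
    have "a s > 0" using that a_pos by simp
    then have "sqrt (f s) * sqrt (g s) = \<bar>indicator {x..y} s * deriv v s\<bar>"
      by (auto simp: f_def g_def indicator_def real_sqrt_mult real_sqrt_divide)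
    with f(2)[OF that] g(2)[OF that] show ?thesis by (simp add: powr_half_sqrt)
  qed
  note H = Holder_interpolation[of "1/2", OF _ _ f(1) g(1) f(2) g(2)]
  have "integrable I_meas (\<lambda>s. f s powr (1/2) * g s powr (1 - 1/2))"
    using H(1) by simp
  also have "?this \<longleftrightarrow> integrable I_meas (\<lambda>s. \<bar>indicator {x..y} s * deriv v s\<bar>)"
    by (rule Bochner_Integration.integrable_cong[OF refl fg])
  finally have absint: "integrable I_meas (\<lambda>s. \<bar>indicator {x..y} s * deriv v s\<bar>)" .
  have meas: "(\<lambda>s. indicator {x..y} s * deriv v s) \<in> borel_measurable I_meas"
  proof -
    have "{x..y} \<in> sets I_meas" using sub by (auto simp: sets_restrict_space_iff)
    then show ?thesis
      using H1_energy_integrable(3)[OF v] by (intro borel_measurable_times borel_measurable_indicator)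
  qed
  have int: "integrable I_meas (\<lambda>s. indicator {x..y} s * deriv v s)"
    by (rule integrable_abs_cancel[OF absint meas])
  have eq: "indicator {-1<..<1} s *\<^sub>R (indicator {x..y} s * deriv v s) = indicator {x..y} s *\<^sub>R deriv v s" for s
    using sub by (auto simp: indicator_def)
  \<comment> \<open>Hoelder's inequality has supplied absolute integrability, so the gauge integral
    in \<open>FTC\<close> coincides with a Lebesgue integral.\<close>
  have "set_integrable lebesgue {x..y} (deriv v)"
    using int unfolding set_integrable_def
    by (subst (asm) integrable_restrict_space) (simp, simp only: eq)
  then have "(deriv v has_integral (LINT s:{x..y}|lebesgue. deriv v s)) {x..y}"
    by (rule has_integral_set_lebesgue)
  with FTC have "v y - v x = (LINT s:{x..y}|lebesgue. deriv v s)" by (rule has_integral_unique)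
  also have "\<dots> = (\<integral>s. indicator {x..y} s * deriv v s \<partial>I_meas)"
    unfolding set_lebesgue_integral_def by (subst integral_restrict_space) (simp, simp only: eq)
  finally have "\<bar>v y - v x\<bar> \<le> (\<integral>s. \<bar>indicator {x..y} s * deriv v s\<bar> \<partial>I_meas)"
    by (simp add: integral_abs_bound)
  also have "\<dots> = (\<integral>s. f s powr (1/2) * g s powr (1 - 1/2) \<partial>I_meas)"
    using fg by (intro Bochner_Integration.integral_cong) auto
  also have "\<dots> \<le> (\<integral>s. f s \<partial>I_meas) powr (1/2) * (\<integral>s. g s \<partial>I_meas) powr (1 - 1/2)"
    using H(2) by simp
  also have "\<dots> = sqrt ((\<integral>s. f s \<partial>I_meas) * (\<integral>s. g s \<partial>I_meas))"
  proof -
    have "(\<integral>s. f s \<partial>I_meas) \<ge> 0" "(\<integral>s. g s \<partial>I_meas) \<ge> 0"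
      using f g by (auto intro!: Bochner_Integration.integral_nonneg)
    then show ?thesis by (simp add: powr_half_sqrt real_sqrt_mult)
  qed
  finally have "(v y - v x)\<^sup>2 \<le> (\<integral>s. f s \<partial>I_meas) * (\<integral>s. g s \<partial>I_meas)"
    by (rule sqrt_ge_absD)
  then show ?thesis
    unfolding f_def g_def inverse_a_restrict(2)[OF xy] .
qed

lemma H1_xi_bound:
  assumes v: "v \<in> H1 a" and x: "x \<in> {-1<..<1}"
  shows "(v x - v 0)\<^sup>2 \<le> \<bar>xi a x\<bar> * (\<integral>s. a s * (deriv v s)\<^sup>2 \<partial>I_meas)"
proof -
  have G: "(\<integral>s. a s * (deriv v s)\<^sup>2 \<partial>I_meas) \<ge> 0"
    using a_pos by (intro Bochner_Integration.integral_nonneg) (simp add: less_imp_le)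
  show ?thesis
  proof (cases "0 \<le> x")
    case True
    have "(v x - v 0)\<^sup>2 \<le> (LBINT s=ereal 0..x. 1 / a s) * (\<integral>s. a s * (deriv v s)\<^sup>2 \<partial>I_meas)"
      using H1_increment_bound[OF v, of 0 x] x True by simp
    also have "\<dots> \<le> \<bar>xi a x\<bar> * (\<integral>s. a s * (deriv v s)\<^sup>2 \<partial>I_meas)"
      using G unfolding xi_def by (intro mult_right_mono) (auto simp: zero_ereal_def)
    finally show ?thesis .
  next
    case False
    \<comment> \<open>For negative \<open>x\<close> the integral runs from \<open>x\<close> to 0 and
      equals \<open>- xi a x\<close>, which the absolute value absorbs.\<close>
    have "(v x - v 0)\<^sup>2 \<le> (LBINT s=x..ereal 0. 1 / a s) * (\<integral>s. a s * (deriv v s)\<^sup>2 \<partial>I_meas)"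
      using H1_increment_bound[OF v, of x 0] x False by (simp add: power2_commute)
    also have "\<dots> \<le> \<bar>xi a x\<bar> * (\<integral>s. a s * (deriv v s)\<^sup>2 \<partial>I_meas)"
      using G interval_integral_endpoints_reverse[of "ereal x" "ereal 0" "\<lambda>s. 1 / a s"]
      unfolding xi_def by (intro mult_right_mono) (auto simp: zero_ereal_def)
    finally show ?thesis .
  qed
qed

lemma H1_pointwise_bound:
  assumes v: "v \<in> H1 a" and x: "x \<in> {-1<..<1}" and xi: "integrable I_meas (xi a)"
  shows "(v x)\<^sup>2 \<le> (H1_norm a v)\<^sup>2 * weight a x"
proof -
  define G where "G = (\<integral>s. a s * (deriv v s)\<^sup>2 \<partial>I_meas)"
  define L where "L = (\<integral>s. (v s)\<^sup>2 \<partial>I_meas)"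
  define X where "X = (\<integral>s. \<bar>xi a s\<bar> \<partial>I_meas)"
  have nn: "G \<ge> 0" "L \<ge> 0" "X \<ge> 0"
    unfolding G_def L_def X_def using a_pos
    by (auto intro!: Bochner_Integration.integral_nonneg simp: less_imp_le)
  \<comment> \<open>The difference of the two sides is
    \<open>(\<alpha> - 2 * \<beta>)\<^sup>2\<close>.\<close>
  have sq2: "\<alpha>\<^sup>2 \<le> 2 * \<beta>\<^sup>2 + 2 * (\<alpha> - \<beta>)\<^sup>2" for \<alpha> \<beta> :: real
    using zero_le_power2[of "\<alpha> - 2 * \<beta>"] by (simp add: power2_eq_square algebra_simps)
  have vint: "integrable I_meas (\<lambda>s. (v s)\<^sup>2)" using v by (simp add: H1_def Lp_space_2_iff)
  \<comment> \<open>Averaging over \<open>s\<close>: the interval has length 2, which cancels the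
    factor 2 on the right and leaves \<open>L + X * G\<close>.\<close>
  have "(\<integral>s. (v 0)\<^sup>2 \<partial>I_meas) \<le> (\<integral>s. 2 * (v s)\<^sup>2 + 2 * (\<bar>xi a s\<bar> * G) \<partial>I_meas)"
  proof (rule integral_mono)
    fix s assume "s \<in> space I_meas"
    then have "(v s - v 0)\<^sup>2 \<le> \<bar>xi a s\<bar> * G" using H1_xi_bound[OF v] by (simp add: G_def)
    then show "(v 0)\<^sup>2 \<le> 2 * (v s)\<^sup>2 + 2 * (\<bar>xi a s\<bar> * G)"
      using sq2[of "v 0" "v s"] by (simp add: power2_commute)
  qed (use vint xi in \<open>auto intro!: finite_measure.integrable_const finite_measureI simp: emeasure_restrict_space\<close>)
  also have "\<dots> = 2 * L + 2 * (X * G)"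
    using vint xi by (simp add: L_def X_def)
  finally have v0: "(v 0)\<^sup>2 \<le> L + X * G"
    by (simp add: measure_restrict_space)
  have vx: "(v x)\<^sup>2 \<le> 2 * (v 0)\<^sup>2 + 2 * (\<bar>xi a x\<bar> * G)"
    using sq2[of "v x" "v 0"] H1_xi_bound[OF v x] by (simp add: G_def)
  have "(v x)\<^sup>2 \<le> 2 * (L + X * G) + 2 * (\<bar>xi a x\<bar> * G)"
    using vx mult_left_mono[OF v0, of 2] by simp
  \<comment> \<open>The nonnegative terms added here are those missing from the product
    \<open>(L + G) * weight a x\<close>.\<close>
  also have "\<dots> \<le> 2 * (L + X * G) + 2 * (\<bar>xi a x\<bar> * G) + (2 * X * L + 2 * G + 2 * (\<bar>xi a x\<bar> * L))"
    using nn by simp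
  also have "\<dots> = (L + G) * weight a x"
    by (simp add: weight_def X_def algebra_simps)
  finally show ?thesis
    unfolding H1_norm_sq[OF v] G_def[symmetric] L_def[symmetric] .
qed


end

section \<open>Integrability of the weight and the spatial estimate\<close>

lemma finite_I_meas: "finite_measure I_meas"
  by (auto intro!: finite_measureI simp: emeasure_restrict_space)

lemma power2_powr: "(x\<^sup>2) powr r = \<bar>x :: real\<bar> powr (2 * r)"
  by (metis abs_powr_2 powr_powr)

text \<open>The sum is at most twice the larger term, and the power of the maximum is one of the two
  summands on the right.\<close>

lemma powr_add_le:
  fixes x y q :: real
  assumes "x \<ge> 0" "y \<ge> 0" "q \<ge> 0"
  shows "(x + y) powr q \<le> 2 powr q * (x powr q + y powr q)"
proof -
  have "(x + y) powr q \<le> (2 * max x y) powr q"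
    using assms by (intro powr_mono2) auto
  also have "\<dots> = 2 powr q * max x y powr q" using assms by (simp add: powr_mult)
  also have "\<dots> \<le> 2 powr q * (x powr q + y powr q)"
    by (intro mult_left_mono) (auto simp: max_def)
  finally show ?thesis .
qed

text \<open>From \<open>p \<ge> 1\<close> the exponent \<open>p / (2 - p)\<close> is at least 1, and
  over a finite measure such a Lebesgue space lies in the space of integrable functions.\<close>

lemma xi_integrable:
  assumes p: "1 \<le> p" "p < 2" and xi: "xi a \<in> Lp_space I_meas (p / (2 - p))"
  shows "integrable I_meas (xi a)"
proof (rule Bochner_Integration.integrable_bound)
  let ?q = "p / (2 - p)"
  have q: "?q \<ge> 1" using p by (simp add: field_simps)
  interpret finite_measure I_meas by (rule finite_I_meas)
  show "integrable I_meas (\<lambda>x. 1 + \<bar>xi a x\<bar> powr ?q)"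
    using xi by (auto simp: Lp_space_def)
  show "xi a \<in> borel_measurable I_meas" using xi by (simp add: Lp_space_def)
  have "\<bar>xi a x\<bar> \<le> 1 + \<bar>xi a x\<bar> powr ?q" for x
  proof (cases "\<bar>xi a x\<bar> \<le> 1")
    case False
    then have "\<bar>xi a x\<bar> powr 1 \<le> \<bar>xi a x\<bar> powr ?q" using q by (intro powr_mono) auto
    with False show ?thesis by simp
  qed (simp add: add_increasing2)
  then show "AE x in I_meas. norm (xi a x) \<le> norm (1 + \<bar>xi a x\<bar> powr ?q)" by simp
qed

lemma weight_powr_integrable:
  assumes p: "1 \<le> p" "p < 2" and xi: "xi a \<in> Lp_space I_meas (p / (2 - p))"
  shows "integrable I_meas (\<lambda>x. weight a x powr (p / (2 - p)))"
proof (rule Bochner_Integration.integrable_bound)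
  let ?q = "p / (2 - p)"
  let ?c = "2 * (1 + (\<integral>s. \<bar>xi a s\<bar> \<partial>I_meas))"
  interpret finite_measure I_meas by (rule finite_I_meas)
  have c: "?c \<ge> 0" by (simp add: add_nonneg_nonneg)
  show "integrable I_meas (\<lambda>x. 2 powr ?q * (?c powr ?q + 2 powr ?q * \<bar>xi a x\<bar> powr ?q))"
    using xi by (auto simp: Lp_space_def)
  have [measurable]: "xi a \<in> borel_measurable I_meas" using xi by (simp add: Lp_space_def)
  show "(\<lambda>x. weight a x powr ?q) \<in> borel_measurable I_meas"
    unfolding weight_def by measurable
  have "weight a x powr ?q \<le> 2 powr ?q * (?c powr ?q + 2 powr ?q * \<bar>xi a x\<bar> powr ?q)" for x
    using powr_add_le[OF c, of "2 * \<bar>xi a x\<bar>" ?q] p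
    by (simp add: weight_def powr_mult)
  then show "AE x in I_meas. norm (weight a x powr ?q)
      \<le> norm (2 powr ?q * (?c powr ?q + 2 powr ?q * \<bar>xi a x\<bar> powr ?q))"
    by (auto intro!: AE_I2 order_trans[OF _ abs_ge_self])
qed

lemma H1_Lp_bound:
  fixes a :: "real \<Rightarrow> real" and p :: real
  assumes a_cont: "continuous_on {-1<..<1} a" and a_pos: "\<And>x. x \<in> {-1<..<1} \<Longrightarrow> a x > 0"
    and p: "1 \<le> p" "p < 2" and xi: "xi a \<in> Lp_space I_meas (p / (2 - p))"
    and v: "v \<in> H1 a"
  shows "integrable I_meas (\<lambda>x. \<bar>v x\<bar> powr (2 * p))"
    and "(\<integral>x. \<bar>v x\<bar> powr (2 * p) \<partial>I_meas)
      \<le> (\<integral>x. weight a x powr (p / (2 - p)) \<partial>I_meas) powr (1 - p / 2)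
          * ((H1_norm a v)\<^sup>2) powr (p / 2) * (\<integral>x. (v x)\<^sup>2 \<partial>I_meas) powr (p / 2)"
proof -
  let ?q = "p / (2 - p)"
  let ?N = "((H1_norm a v)\<^sup>2) powr (p / 2)"
  let ?F = "\<lambda>x. (v x)\<^sup>2 powr (p / 2) * (weight a x powr ?q) powr (1 - p / 2)"
  have vm: "v \<in> borel_measurable I_meas" and vint: "integrable I_meas (\<lambda>x. (v x)\<^sup>2)"
    using v by (auto simp: H1_def Lp_space_2_iff)
  \<comment> \<open>The interpolated functions are \<open>(v x)\<^sup>2\<close> and the power of the
    weight, with \<open>\<theta> = p / 2\<close>, which is below 1 because
    \<open>p < 2\<close>.\<close>
  note H = Holder_interpolation[OF _ _ vint weight_powr_integrable[OF p xi], of "p / 2"]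
  have H1: "integrable I_meas ?F"
    using H(1) p by simp
  have H2: "(\<integral>x. ?F x \<partial>I_meas)
      \<le> (\<integral>x. (v x)\<^sup>2 \<partial>I_meas) powr (p / 2) * (\<integral>x. weight a x powr ?q \<partial>I_meas) powr (1 - p / 2)"
    using H(2) p by simp
  have pt: "\<bar>v x\<bar> powr (2 * p) \<le> ?N * ?F x" if x: "x \<in> {-1<..<1}" for x
  proof -
    have w: "weight a x > 0" using weight_ge_2[of a x] by simp
    have "\<bar>v x\<bar> powr (2 * p) = (v x)\<^sup>2 powr (p / 2) * (v x)\<^sup>2 powr (p / 2)"
      by (simp add: power2_powr flip: powr_add)
    also have "\<dots> \<le> (v x)\<^sup>2 powr (p / 2) * ((H1_norm a v)\<^sup>2 * weight a x) powr (p / 2)"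
      using H1_pointwise_bound[OF a_cont a_pos v x xi_integrable[OF p xi]] p
      by (intro mult_left_mono powr_mono2) auto
    also have "\<dots> = (v x)\<^sup>2 powr (p / 2) * (?N * weight a x powr (p / 2))"
      using w by (simp add: powr_mult)
    \<comment> \<open>This identity singles out the exponent \<open>p / (2 - p)\<close>: raised to
      the Hoelder exponent \<open>1 - p / 2\<close>, it returns the power \<open>p / 2\<close> left
      by the pointwise bound.\<close>
    also have "weight a x powr (p / 2) = (weight a x powr ?q) powr (1 - p / 2)"
    proof -
      have "p / (2 - p) * (1 - p / 2) = p / 2" using p by (simp add: divide_simps)
      then show ?thesis by (simp only: powr_powr)
    qed
    finally show ?thesis by (simp add: mult_ac)
  qed
  show int: "integrable I_meas (\<lambda>x. \<bar>v x\<bar> powr (2 * p))"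
  proof (rule Bochner_Integration.integrable_bound)
    show "integrable I_meas (\<lambda>x. ?N * ?F x)" using H1 by (rule integrable_mult_right)
    show "(\<lambda>x. \<bar>v x\<bar> powr (2 * p)) \<in> borel_measurable I_meas" using vm by measurable
    show "AE x in I_meas. norm (\<bar>v x\<bar> powr (2 * p)) \<le> norm (?N * ?F x)"
      using pt by (intro AE_I2) force
  qed
  have "(\<integral>x. \<bar>v x\<bar> powr (2 * p) \<partial>I_meas) \<le> (\<integral>x. ?N * ?F x \<partial>I_meas)"
    using pt by (intro integral_mono int integrable_mult_right H1) simp
  also have "\<dots> = ?N * (\<integral>x. ?F x \<partial>I_meas)" by simp
  also have "\<dots> \<le> ?N * ((\<integral>x. (v x)\<^sup>2 \<partial>I_meas) powr (p / 2) * (\<integral>x. weight a x powr ?q \<partial>I_meas) powr (1 - p / 2))"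
    by (intro mult_left_mono H2) simp
  finally show "(\<integral>x. \<bar>v x\<bar> powr (2 * p) \<partial>I_meas)
      \<le> (\<integral>x. weight a x powr ?q \<partial>I_meas) powr (1 - p / 2) * ?N * (\<integral>x. (v x)\<^sup>2 \<partial>I_meas) powr (p / 2)"
    by (simp add: mult_ac)
qed

section \<open>Measurability and integration on the product\<close>

text \<open>The product formula gives zero times infinity, which is zero in
  \<open>ennreal\<close>.\<close>

lemma null_sets_lborel_Times_UNIV:
  fixes N :: "'a :: euclidean_space set"
  assumes "N \<in> null_sets lborel"
  shows "N \<times> (UNIV :: 'b :: euclidean_space set) \<in> null_sets lborel"
proof -
  have NB: "N \<in> sets lborel" using assms by (rule null_setsD2)
  have "emeasure (lborel \<Otimes>\<^sub>M lborel) (N \<times> (UNIV :: 'b set)) = emeasure lborel N * emeasure lborel (UNIV :: 'b set)"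
    by (rule lborel.emeasure_pair_measure_Times[OF NB]) auto
  then have "emeasure (lborel \<Otimes>\<^sub>M lborel) (N \<times> (UNIV :: 'b set)) = 0"
    using assms by (simp add: null_setsD1)
  moreover have "N \<times> (UNIV :: 'b set) \<in> sets (lborel \<Otimes>\<^sub>M lborel)"
    by (rule pair_measureI[OF NB]) auto
  ultimately have "N \<times> (UNIV :: 'b set) \<in> null_sets (lborel \<Otimes>\<^sub>M lborel)"
    by (rule null_setsI)
  then show ?thesis by (simp only: lborel_prod)
qed

text \<open>Measurability into a completion requires preimages of null sets to be null; for a
  projection these preimages are cylinders over null sets.\<close>

lemma measurable_fst_lebesgue:
  "fst \<in> (lebesgue :: ('a :: euclidean_space \<times> 'b :: euclidean_space) measure) \<rightarrow>\<^sub>M lebesgue"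
proof (rule completion.measurable_completion2)
  show fst: "fst \<in> (lebesgue :: ('a \<times> 'b) measure) \<rightarrow>\<^sub>M lborel"
    by (rule measurable_completion) (simp flip: lborel_prod)
  show "null_sets lborel \<subseteq> null_sets (distr (lebesgue :: ('a \<times> 'b) measure) lborel fst)"
  proof
    fix N :: "'a set" assume N: "N \<in> null_sets lborel"
    have "fst -` N = N \<times> (UNIV :: 'b set)" by auto
    with null_sets_lborel_Times_UNIV[OF N, where 'b = 'b]
    have "fst -` N \<in> null_sets (lebesgue :: ('a \<times> 'b) measure)"
      by (simp add: null_sets_completionI)
    then show "N \<in> null_sets (distr (lebesgue :: ('a \<times> 'b) measure) lborel fst)"
      using null_setsD2[OF N] fst by (simp add: null_sets_distr_iff)
  qed
qed

lemma AE_lebesgue_fst: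
  fixes P :: "'a :: euclidean_space \<Rightarrow> bool"
  assumes "AE t in lebesgue. P t"
  shows "AE z in (lebesgue :: ('a \<times> 'b :: euclidean_space) measure). P (fst z)"
proof -
  have "AE t in lborel. P t" using assms by (simp add: AE_completion_iff)
  then obtain N where N: "N \<in> null_sets lborel" "{t. \<not> P t} \<subseteq> N"
    by (auto simp: eventually_ae_filter)
  have "AE z in (lborel :: ('a \<times> 'b) measure). P (fst z)"
    using N by (intro AE_I'[OF null_sets_lborel_Times_UNIV[OF N(1)]]) auto
  then show ?thesis by (simp add: AE_completion_iff)
qed

text \<open>Lebesgue measure on the product is the completion of the product of Borel measures.
  Tonelli's theorem is applied to a Borel function \<open>F'\<close> equal to \<open>F\<close>
  almost everywhere; for almost every \<open>t\<close> the sections agree almost everywhere, so the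
  inner integrals coincide.\<close>

lemma lebesgue_Tonelli:
  fixes F :: "'a :: euclidean_space \<times> 'b :: euclidean_space \<Rightarrow> ennreal"
  assumes F: "F \<in> borel_measurable lebesgue"
  shows "(\<lambda>t. \<integral>\<^sup>+x. F (t, x) \<partial>lebesgue) \<in> borel_measurable lebesgue"
    and "(\<integral>\<^sup>+z. F z \<partial>lebesgue) = (\<integral>\<^sup>+t. (\<integral>\<^sup>+x. F (t, x) \<partial>lebesgue) \<partial>lebesgue)"
proof -
  obtain F' where F': "F' \<in> borel_measurable lborel" and eq: "AE z in lborel. F z = F' z"
    using completion_ex_borel_measurable[OF F] by auto
  have F'p: "F' \<in> borel_measurable (lborel \<Otimes>\<^sub>M lborel)" using F' by (simp only: lborel_prod)
  have "AE z in lborel \<Otimes>\<^sub>M lborel. F z = F' z" using eq by (simp only: lborel_prod)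
  then have "AE t in lborel. AE x in lborel. F (t, x) = F' (t, x)" by (rule lborel_pair.AE_pair)
  then have inner: "AE t in lborel. (\<integral>\<^sup>+x. F' (t, x) \<partial>lborel) = (\<integral>\<^sup>+x. F (t, x) \<partial>lebesgue)"
  proof eventually_elim
    case (elim t)
    then have "(\<integral>\<^sup>+x. F (t, x) \<partial>lborel) = (\<integral>\<^sup>+x. F' (t, x) \<partial>lborel)" by (rule nn_integral_cong_AE)
    then show ?case by (simp add: nn_integral_completion)
  qed
  have meas: "(\<lambda>t. \<integral>\<^sup>+x. F' (t, x) \<partial>lborel) \<in> borel_measurable lborel"
    by (rule lborel.borel_measurable_nn_integral_fst[OF F'p])
  show "(\<lambda>t. \<integral>\<^sup>+x. F (t, x) \<partial>lebesgue) \<in> borel_measurable lebesgue"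
    by (rule completion.borel_measurable_cong_AE[OF measurable_completion[OF meas]])
      (use inner in \<open>auto simp: AE_completion_iff\<close>)
  have "(\<integral>\<^sup>+z. F z \<partial>lebesgue) = (\<integral>\<^sup>+z. F' z \<partial>lborel)"
    unfolding nn_integral_completion using eq by (rule nn_integral_cong_AE)
  also have "\<dots> = (\<integral>\<^sup>+t. (\<integral>\<^sup>+x. F' (t, x) \<partial>lborel) \<partial>lborel)"
    using lborel.nn_integral_fst[OF F'p] by (simp only: lborel_prod)
  also have "\<dots> = (\<integral>\<^sup>+t. (\<integral>\<^sup>+x. F (t, x) \<partial>lebesgue) \<partial>lebesgue)"
    unfolding nn_integral_completion[where M = "lborel :: 'a measure"] using inner by (rule nn_integral_cong_AE)
  finally show "(\<integral>\<^sup>+z. F z \<partial>lebesgue) = (\<integral>\<^sup>+t. (\<integral>\<^sup>+x. F (t, x) \<partial>lebesgue) \<partial>lebesgue)" .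
qed

section \<open>Joint measurability of Bochner measurable functions\<close>

abbreviation (input) Q_set :: "real \<Rightarrow> (real \<times> real) set" where
  "Q_set T \<equiv> {0<..<T} \<times> {-1<..<1}"

lemma Q_set_sets: "Q_set T \<in> sets lebesgue"
  by (intro borel_open[THEN sets_completionI_sets[of _ lborel, simplified]] open_Times) auto

text \<open>A simple function has finitely many values \<open>v\<close>, each continuous in space.
  It is thus a finite sum of products of a measurable indicator in time and a continuous function in
  space.\<close>

lemma simple_function_H1_measurable:
  assumes s: "simple_function (time_meas T) s" and H: "\<And>t. t \<in> {0<..<T} \<Longrightarrow> s t \<in> H1 a"
  shows "(\<lambda>(t, x). s t x) \<in> borel_measurable (Q_meas T)"
proof -
  define V where "V = s ` {0<..<T}"
  have fin: "finite V" using simple_functionD(1)[OF s] by (simp add: V_def)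
  have "(\<lambda>z. \<Sum>v\<in>V. indicator (s -` {v} \<inter> {0<..<T}) (fst z) * v (snd z)) \<in> borel_measurable (Q_meas T)"
  proof (intro borel_measurable_sum borel_measurable_times)
    fix v assume v: "v \<in> V"
    have "s -` {v} \<inter> {0<..<T} \<in> sets (time_meas T)"
      using simple_functionD(2)[OF s, of "{v}"] by simp
    then have "s -` {v} \<inter> {0<..<T} \<in> sets lebesgue"
      by (auto simp: sets_restrict_space_iff)
    then have "(\<lambda>z :: real \<times> real. indicator (s -` {v} \<inter> {0<..<T}) (fst z) :: real) \<in> borel_measurable lebesgue"
      by (intro measurable_compose[OF measurable_fst_lebesgue] borel_measurable_indicator)
    then show "(\<lambda>z :: real \<times> real. indicator (s -` {v} \<inter> {0<..<T}) (fst z) :: real) \<in> borel_measurable (Q_meas T)"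
      by (rule measurable_restrict_space1)
    have "continuous_on {-1<..<1} v"
      using v H H1_continuous_on[of _ a] by (auto simp: V_def)
    then have "continuous_on (Q_set T) (\<lambda>z. v (snd z))"
      by (rule continuous_on_compose2) (auto intro: continuous_intros)
    then show "(\<lambda>z. v (snd z)) \<in> borel_measurable (Q_meas T)"
      using Q_set_sets by (rule continuous_imp_measurable_on_sets_lebesgue)
  qed
  also have "?this \<longleftrightarrow> ?thesis"
  proof (rule measurable_cong)
    fix z assume "z \<in> space (Q_meas T)"
    then have t: "fst z \<in> {0<..<T}" by auto
    have "(\<Sum>v\<in>V. indicator (s -` {v} \<inter> {0<..<T}) (fst z) * v (snd z)) = (\<Sum>v\<in>V. if v = s (fst z) then v (snd z) else 0)"
      using t by (intro sum.cong) (auto simp: indicator_def)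
    also have "\<dots> = s (fst z) (snd z)"
      using fin t by (simp add: V_def)
    finally show "(\<Sum>v\<in>V. indicator (s -` {v} \<inter> {0<..<T}) (fst z) * v (snd z)) = (case z of (t, x) \<Rightarrow> s t x)"
      by (simp add: split_beta)
  qed
  finally show ?thesis .
qed

context
  fixes a :: "real \<Rightarrow> real"
  assumes a_cont: "continuous_on {-1<..<1} a" and a_pos: "\<And>x. x \<in> {-1<..<1} \<Longrightarrow> a x > 0"
    and xi: "integrable I_meas (xi a)"
begin

text \<open>Evaluation at \<open>x\<close> is continuous for the norm: the pointwise bound is
  applied to the difference, with \<open>weight a x\<close> a fixed number.\<close>

lemma H1_norm_tendsto_pointwise:
  assumes "\<And>n. s n \<in> H1 a" "v \<in> H1 a" "x \<in> {-1<..<1}"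
    and lim: "(\<lambda>n. H1_norm a (\<lambda>x. s n x - v x)) \<longlonglongrightarrow> 0"
  shows "(\<lambda>n. s n x) \<longlonglongrightarrow> v x"
proof -
  have "(\<lambda>n. (s n x - v x)\<^sup>2) \<longlonglongrightarrow> 0"
  proof (rule tendsto_sandwich)
    show "\<forall>\<^sub>F n in sequentially. 0 \<le> (s n x - v x)\<^sup>2" by simp
    show "\<forall>\<^sub>F n in sequentially. (s n x - v x)\<^sup>2 \<le> (H1_norm a (\<lambda>x. s n x - v x))\<^sup>2 * weight a x"
      using H1_pointwise_bound[OF a_cont a_pos H1_diff[OF assms(1,2)] assms(3) xi] by simp
    have "(\<lambda>n. (H1_norm a (\<lambda>x. s n x - v x))\<^sup>2 * weight a x) \<longlonglongrightarrow> 0\<^sup>2 * weight a x"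
      by (intro tendsto_intros lim)
    then show "(\<lambda>n. (H1_norm a (\<lambda>x. s n x - v x))\<^sup>2 * weight a x) \<longlonglongrightarrow> 0" by simp
  qed simp
  then have "(\<lambda>n. sqrt ((s n x - v x)\<^sup>2)) \<longlonglongrightarrow> sqrt 0" by (intro tendsto_real_sqrt)
  then have "(\<lambda>n. s n x - v x) \<longlonglongrightarrow> 0" by (simp add: tendsto_rabs_zero_iff)
  then show ?thesis by (simp add: LIM_zero_iff)
qed

text \<open>For almost every \<open>t\<close> the approximating simple functions converge at every
  \<open>x\<close>. The exceptional times form a null cylinder in the product, off which
  \<open>u\<close> is a limit of jointly measurable functions.\<close>

lemma bochner_H1_measurable:
  assumes u: "bochner_measurable (time_meas T) (H1 a) (H1_norm a) u"
  shows "(\<lambda>(t, x). u t x) \<in> borel_measurable (Q_meas T)"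
proof -
  obtain s where s: "\<And>n. simple_function (time_meas T) (s n)" "\<And>n t. t \<in> {0<..<T} \<Longrightarrow> s n t \<in> H1 a"
    and lim: "AE t in time_meas T. (\<lambda>n. H1_norm a (\<lambda>x. s n t x - u t x)) \<longlonglongrightarrow> 0"
    using u unfolding bochner_measurable_def space_lebesgue_on by blast
  have uH: "AE t in time_meas T. u t \<in> H1 a" using u by (simp add: bochner_measurable_def)
  have "AE t in time_meas T. \<forall>x\<in>{-1<..<1}. (\<lambda>n. s n t x) \<longlonglongrightarrow> u t x"
    using lim uH AE_space
  proof eventually_elim
    case (elim t)
    then show ?case using H1_norm_tendsto_pointwise[of "\<lambda>n. s n t" "u t"] s(2)[of t] by auto
  qed
  then have "AE t in lebesgue. t \<in> {0<..<T} \<longrightarrow> (\<forall>x\<in>{-1<..<1}. (\<lambda>n. s n t x) \<longlonglongrightarrow> u t x)"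
    by (simp add: AE_restrict_space_iff)
  from AE_lebesgue_fst[OF this, where 'b = real]
  have ae: "AE z in lebesgue. z \<in> Q_set T \<longrightarrow> (\<lambda>n. s n (fst z) (snd z)) \<longlonglongrightarrow> u (fst z) (snd z)"
    by eventually_elim auto
  then obtain N where N: "N \<in> null_sets lebesgue"
    and conv: "\<And>z. z \<in> Q_set T - N \<Longrightarrow> (\<lambda>n. s n (fst z) (snd z)) \<longlonglongrightarrow> u (fst z) (snd z)"
    unfolding completion.AE_iff_null_sets by auto
  \<comment> \<open>Cutting off outside \<open>Q_set T - N\<close> makes the convergence hold
    everywhere; the values on \<open>N\<close> are restored afterwards by completeness.\<close>
  have "(\<lambda>z. indicator (Q_set T - N) z * u (fst z) (snd z)) \<in> borel_measurable lebesgue"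
  proof (rule borel_measurable_LIMSEQ_real)
    fix n
    have "(\<lambda>z. indicator (Q_set T) z * s n (fst z) (snd z)) \<in> borel_measurable lebesgue"
      using simple_function_H1_measurable[OF s(1)[of n] s(2)[of _ n]] Q_set_sets[of T]
      by (simp add: borel_measurable_restrict_space_iff split_beta)
    moreover have "(\<lambda>z. indicator (- N) z :: real) \<in> borel_measurable lebesgue"
      using sets.compl_sets[OF null_setsD2[OF N]]
      by (intro borel_measurable_indicator) (simp add: Compl_eq_Diff_UNIV)
    ultimately have "(\<lambda>z. indicator (- N) z * (indicator (Q_set T) z * s n (fst z) (snd z))) \<in> borel_measurable lebesgue"
      by (rule borel_measurable_times[rotated])
    also have "(\<lambda>z. indicator (- N) z * (indicator (Q_set T) z * s n (fst z) (snd z)))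
        = (\<lambda>z. indicator (Q_set T - N) z * s n (fst z) (snd z))"
      by (auto simp: indicator_def)
    finally show "(\<lambda>z. indicator (Q_set T - N) z * s n (fst z) (snd z)) \<in> borel_measurable lebesgue" .
  next
    fix z :: "real \<times> real"
    show "(\<lambda>n. indicator (Q_set T - N) z * s n (fst z) (snd z)) \<longlonglongrightarrow> indicator (Q_set T - N) z * u (fst z) (snd z)"
      using conv[of z] by (cases "z \<in> Q_set T - N") auto
  qed
  moreover have "AE z in lebesgue. indicator (Q_set T - N) z * u (fst z) (snd z) = indicator (Q_set T) z * u (fst z) (snd z)"
    using AE_not_in[OF N] by eventually_elim (auto simp: indicator_def)
  ultimately have "(\<lambda>z. indicator (Q_set T) z * u (fst z) (snd z)) \<in> borel_measurable lebesgue"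
    by (rule borel_measurable_AE)
  then show ?thesis
    using Q_set_sets[of T] by (simp add: borel_measurable_restrict_space_iff split_beta)
qed

end

text \<open>Extension by zero reduces this to the whole plane, since the indicator of the rectangle
  is the product of the indicators of its sides.\<close>

lemma Q_meas_Tonelli:
  fixes F :: "real \<times> real \<Rightarrow> ennreal"
  assumes F: "F \<in> borel_measurable (Q_meas T)"
  shows "(\<lambda>t. \<integral>\<^sup>+x. F (t, x) \<partial>I_meas) \<in> borel_measurable (time_meas T)"
    and "(\<integral>\<^sup>+z. F z \<partial>Q_meas T) = (\<integral>\<^sup>+t. (\<integral>\<^sup>+x. F (t, x) \<partial>I_meas) \<partial>time_meas T)"
proof -
  have G: "(\<lambda>z. F z * indicator (Q_set T) z) \<in> borel_measurable lebesgue"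
    using F Q_set_sets[of T] by (simp add: borel_measurable_restrict_space_iff_ennreal)
  have inner: "(\<integral>\<^sup>+x. F (t, x) * indicator (Q_set T) (t, x) \<partial>lebesgue)
      = (\<integral>\<^sup>+x. F (t, x) \<partial>I_meas) * indicator {0<..<T} t" for t
    by (cases "t \<in> {0<..<T}") (auto simp: nn_integral_restrict_space indicator_times mult.assoc)
  show "(\<lambda>t. \<integral>\<^sup>+x. F (t, x) \<partial>I_meas) \<in> borel_measurable (time_meas T)"
    using lebesgue_Tonelli(1)[OF G] by (simp add: borel_measurable_restrict_space_iff_ennreal inner)
  show "(\<integral>\<^sup>+z. F z \<partial>Q_meas T) = (\<integral>\<^sup>+t. (\<integral>\<^sup>+x. F (t, x) \<partial>I_meas) \<partial>time_meas T)"
    using lebesgue_Tonelli(2)[OF G] Q_set_sets[of T] by (simp add: nn_integral_restrict_space inner)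
qed

section \<open>The embedding\<close>

theorem lemma3p3:
  fixes a :: "real \<Rightarrow> real" and T p :: real
  assumes "C1_on_Icc (-1) 1 a"
    and "\<forall>x\<in>{-1<..<1}. a x > 0"
    and "a (-1) = 0" and "a 1 = 0"
    and "T > 0"
    and "1 \<le> p" and "p < 2"
    and "xi a \<in> Lp_space I_meas (p / (2 - p))"
  shows "(\<forall>u\<in>energy_space a T. (\<lambda>(t, x). u t x) \<in> Lp_space (Q_meas T) (2 * p)) \<and>
         (\<exists>c>0. \<forall>u\<in>energy_space a T.
            Lp_norm (Q_meas T) (2 * p) (\<lambda>(t, x). u t x)
              \<le> c * T powr (1 / (2 * p) * (1 - p / 2)) * B_norm a T u)"
proof -
  have a_cont: "continuous_on {-1<..<1} a"
  proof (rule continuous_on_subset)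
    show "continuous_on {-1..1} a"
      using assms(1) unfolding C1_on_Icc_def by (meson DERIV_continuous_on)
  qed auto
  have a_pos: "\<And>x. x \<in> {-1<..<1} \<Longrightarrow> a x > 0" using assms(2) by blast
  note p = assms(6,7) and xi = assms(8)
  note xi_int = xi_integrable[OF p xi]
  define W where "W = (\<integral>x. weight a x powr (p / (2 - p)) \<partial>I_meas) powr (1 - p / 2)"
  \<comment> \<open>The summand 1 makes \<open>K\<close> visibly positive. The factor
    \<open>(1 + T) powr (p / 2)\<close> comes from the bound of the time integral of the squared
    norm by \<open>(1 + T) * B\<^sup>2\<close>.\<close>
  define K where "K = (W + 1) * (1 + T) powr (p / 2)"
  have W: "W \<ge> 0" by (simp add: W_def)
  have K: "K > 0" using W \<open>T > 0\<close> by (simp add: K_def)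
  have main: "integrable (Q_meas T) (\<lambda>z. \<bar>case z of (t, x) \<Rightarrow> u t x\<bar> powr (2 * p))
      \<and> (\<integral>z. \<bar>case z of (t, x) \<Rightarrow> u t x\<bar> powr (2 * p) \<partial>Q_meas T) \<le> K * T powr (1 - p / 2) * (B_norm a T u) powr (2 * p)
      \<and> (\<lambda>(t, x). u t x) \<in> borel_measurable (Q_meas T) \<and> 0 \<le> B_norm a T u"
    if u: "u \<in> energy_space a T" for u
  proof -
    interpret time: finite_measure "time_meas T"
      using \<open>T > 0\<close> by (auto intro!: finite_measureI simp: emeasure_restrict_space)
    have umeas: "(\<lambda>(t, x). u t x) \<in> borel_measurable (Q_meas T)"
      using u bochner_H1_measurable[OF a_cont a_pos xi_int] by (simp add: energy_space_def bochner_Lp_def)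
    have uH: "AE t in time_meas T. u t \<in> H1 a"
      using u by (simp add: energy_space_def bochner_Lp_def bochner_measurable_def)
    obtain C where C: "AE t in time_meas T. Lp_norm I_meas 2 (u t) \<le> C"
      using u by (auto simp: energy_space_def bochner_Linf_def)
    define n where "n t = (H1_norm a (u t))\<^sup>2" for t
    define L where "L t = (\<integral>x. (u t x)\<^sup>2 \<partial>I_meas)" for t
    define G where "G t = (\<integral>x. a x * (deriv (u t) x)\<^sup>2 \<partial>I_meas)" for t
    have n_int: "integrable (time_meas T) n" and n_nn: "\<And>t. n t \<ge> 0"
      using u by (auto simp: energy_space_def bochner_Lp_def Lp_space_2_iff n_def[abs_def])
    have L_nn: "\<And>t. L t \<ge> 0" by (simp add: L_def)
    have G_nn: "\<And>t. G t \<ge> 0"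
      unfolding G_def using a_pos by (intro Bochner_Integration.integral_nonneg) (simp add: less_imp_le)
    have n_eq: "AE t in time_meas T. n t = L t + G t"
      using uH unfolding n_def L_def G_def by eventually_elim (rule H1_norm_sq[OF a_cont a_pos])
    have nn_L: "AE t in time_meas T. (\<integral>\<^sup>+x. ennreal ((u t x)\<^sup>2) \<partial>I_meas) = ennreal (L t)"
      using uH by eventually_elim (auto simp: L_def H1_def Lp_space_2_iff intro!: nn_integral_eq_integral)
    \<comment> \<open>Tonelli's theorem gives measurability of the inner nonnegative integral, which
      equals \<open>L t\<close> only for almost every \<open>t\<close>, namely where
      \<open>u t\<close> lies in \<open>H1 a\<close>.\<close>
    have L_meas: "L \<in> borel_measurable (time_meas T)"
    proof -
      have "(\<lambda>z. ennreal ((case z of (t, x) \<Rightarrow> u t x)\<^sup>2)) \<in> borel_measurable (Q_meas T)"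
        using umeas by measurable
      from Q_meas_Tonelli(1)[OF this]
      have m: "(\<lambda>t. enn2real (\<integral>\<^sup>+x. ennreal ((u t x)\<^sup>2) \<partial>I_meas)) \<in> borel_measurable (time_meas T)"
        by simp
      show ?thesis
        by (rule lebesgue_on_borel_measurable_cong_AE[OF m])
          (use nn_L L_nn in \<open>auto elim!: eventually_mono\<close>)
    qed
    have L_int: "integrable (time_meas T) L"
      using n_int L_meas
    proof (rule Bochner_Integration.integrable_bound)
      show "AE t in time_meas T. norm (L t) \<le> norm (n t)"
        using n_eq by eventually_elim (use L_nn G_nn in auto)
    qed
    \<comment> \<open>The energy is measurable in time as the almost everywhere difference
      \<open>n - L\<close>; joint measurability of the derivative does not enter.\<close>
    have G_int: "integrable (time_meas T) G"
    proof -
      have d: "integrable (time_meas T) (\<lambda>t. n t - L t)" using n_int L_int by simp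
      have ae: "AE t in time_meas T. n t - L t = G t" using n_eq by eventually_elim simp
      have "G \<in> borel_measurable (time_meas T)"
        by (rule lebesgue_on_borel_measurable_cong_AE[OF borel_measurable_integrable[OF d] _ ae]) simp
      from Bochner_Integration.integrable_cong_AE_imp[OF d this ae] show ?thesis .
    qed
    define S where "S = enn2real (esssup (time_meas T) (\<lambda>t. ennreal (L t)))"
    have S: "S \<ge> 0" by (simp add: S_def)
    \<comment> \<open>The uniform bound \<open>C\<close> makes the essential supremum finite, so
      that \<open>S\<close> represents it and bounds \<open>L\<close> almost everywhere.\<close>
    have "AE t in time_meas T. ennreal (L t) \<le> ennreal (C\<^sup>2)"
      using C
    proof eventually_elim
      case (elim t)
      then have "(Lp_norm I_meas 2 (u t))\<^sup>2 \<le> C\<^sup>2"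
        by (intro power_mono) (auto simp: Lp_norm_def)
      then show ?case by (simp add: L_def Lp_norm_2_sq)
    qed
    then have "esssup (time_meas T) (\<lambda>t. ennreal (L t)) \<le> ennreal (C\<^sup>2)"
      using L_meas by (intro esssup_I) auto
    then have S_eq: "ennreal S = esssup (time_meas T) (\<lambda>t. ennreal (L t))"
      unfolding S_def by (intro ennreal_enn2real le_less_trans[OF _ ennreal_less_top])
    have L_S: "AE t in time_meas T. L t \<le> S"
      using esssup_AE[of "\<lambda>t. ennreal (L t)" "time_meas T", folded S_eq]
      by eventually_elim (simp add: ennreal_le_iff S)
    have IG: "(\<integral>t. G t \<partial>time_meas T) \<ge> 0" using G_nn by simp
    have B_eq: "B_norm a T u = sqrt (S + 2 * (\<integral>t. G t \<partial>time_meas T))"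
      by (simp add: B_norm_def S_def L_def G_def Lp_norm_2_sq)
    define B where "B = B_norm a T u"
    have B: "B \<ge> 0" "B\<^sup>2 = S + 2 * (\<integral>t. G t \<partial>time_meas T)"
      using S IG by (auto simp: B_def B_eq)
    have IN: "(\<integral>t. n t \<partial>time_meas T) \<le> (1 + T) * B\<^sup>2"
    proof -
      have "(\<integral>t. n t \<partial>time_meas T) = (\<integral>t. L t + G t \<partial>time_meas T)"
        using n_eq n_int L_meas G_int by (intro integral_cong_AE) auto
      also have "\<dots> = (\<integral>t. L t \<partial>time_meas T) + (\<integral>t. G t \<partial>time_meas T)"
        using L_int G_int by simp
      also have "(\<integral>t. L t \<partial>time_meas T) \<le> (\<integral>t. S \<partial>time_meas T)"
        using L_int L_S by (intro integral_mono_AE) auto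
      also have "\<dots> = T * S" using \<open>T > 0\<close> by (simp add: measure_restrict_space)
      finally have "(\<integral>t. n t \<partial>time_meas T) \<le> T * S + (\<integral>t. G t \<partial>time_meas T)" by simp
      also have "\<dots> \<le> T * B\<^sup>2 + B\<^sup>2"
        using S IG B \<open>T > 0\<close> by (intro add_mono mult_left_mono) auto
      finally show ?thesis by (simp add: algebra_simps)
    qed
    \<comment> \<open>Hoelder's inequality against the constant 1, whose integral over the time
      interval is \<open>T\<close>: this is the source of the power of \<open>T\<close>.\<close>
    have hold: "integrable (time_meas T) (\<lambda>t. n t powr (p / 2))"
      "(\<integral>t. n t powr (p / 2) \<partial>time_meas T) \<le> (\<integral>t. n t \<partial>time_meas T) powr (p / 2) * T powr (1 - p / 2)"
      using Holder_interpolation[of "p / 2" "time_meas T" n "\<lambda>_. 1"] p n_int n_nn \<open>T > 0\<close>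
      by (auto simp: measure_restrict_space)
    define R where "R = K * T powr (1 - p / 2) * B powr (2 * p)"
    have R: "R \<ge> 0" using K by (simp add: R_def)
    \<comment> \<open>With \<open>L t\<close> replaced by \<open>S\<close>, only the factor
      \<open>n t powr (p / 2)\<close> still depends on time.\<close>
    have slice: "AE t in time_meas T. (\<integral>\<^sup>+x. ennreal (\<bar>u t x\<bar> powr (2 * p)) \<partial>I_meas)
        \<le> ennreal (W * S powr (p / 2) * n t powr (p / 2))"
      using uH L_S
    proof eventually_elim
      case (elim t)
      note sp = H1_Lp_bound[OF a_cont a_pos p xi elim(1)]
      have "(\<integral>x. \<bar>u t x\<bar> powr (2 * p) \<partial>I_meas) \<le> W * n t powr (p / 2) * L t powr (p / 2)"
        using sp(2) by (simp add: W_def n_def L_def)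
      also have "\<dots> \<le> W * n t powr (p / 2) * S powr (p / 2)"
        using elim(2) L_nn W p by (intro mult_left_mono powr_mono2) auto
      finally show ?case
        using nn_integral_eq_integral[OF sp(1)] by (simp add: ennreal_leI mult_ac)
    qed
    have meas: "(\<lambda>z. \<bar>case z of (t, x) \<Rightarrow> u t x\<bar> powr (2 * p)) \<in> borel_measurable (Q_meas T)"
      using umeas by measurable
    \<comment> \<open>Working with nonnegative integrals, the final estimate yields integrability
      over \<open>Q_meas T\<close> as well as the bound.\<close>
    have "(\<integral>\<^sup>+z. ennreal (\<bar>case z of (t, x) \<Rightarrow> u t x\<bar> powr (2 * p)) \<partial>Q_meas T)
        = (\<integral>\<^sup>+t. (\<integral>\<^sup>+x. ennreal (\<bar>u t x\<bar> powr (2 * p)) \<partial>I_meas) \<partial>time_meas T)"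
      using Q_meas_Tonelli(2)[of "\<lambda>z. ennreal (\<bar>case z of (t, x) \<Rightarrow> u t x\<bar> powr (2 * p))" T] meas by simp
    also have "\<dots> \<le> (\<integral>\<^sup>+t. ennreal (W * S powr (p / 2) * n t powr (p / 2)) \<partial>time_meas T)"
      using slice by (rule nn_integral_mono_AE)
    also have "\<dots> = ennreal (\<integral>t. W * S powr (p / 2) * n t powr (p / 2) \<partial>time_meas T)"
      using hold(1) W by (intro nn_integral_eq_integral) auto
    also have "\<dots> \<le> ennreal R"
    proof (rule ennreal_leI)
      have "(\<integral>t. W * S powr (p / 2) * n t powr (p / 2) \<partial>time_meas T)
          = W * S powr (p / 2) * (\<integral>t. n t powr (p / 2) \<partial>time_meas T)" by simp
      \<comment> \<open>One factor \<open>B powr p\<close> comes from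
        \<open>S \<le> B\<^sup>2\<close>, the other from the time integral of \<open>n\<close>;
        together they give the power \<open>2 * p\<close>.\<close>
      also have "\<dots> \<le> (W + 1) * B powr p * (((1 + T) * B\<^sup>2) powr (p / 2) * T powr (1 - p / 2))"
      proof (intro mult_mono)
        have "S powr (p / 2) \<le> (B\<^sup>2) powr (p / 2)" using S B IG p by (intro powr_mono2) auto
        also have "(B\<^sup>2) powr (p / 2) = B powr p" using B(1) by (simp add: power2_powr)
        finally show "S powr (p / 2) \<le> B powr p" .
        have "(\<integral>t. n t \<partial>time_meas T) powr (p / 2) \<le> ((1 + T) * B\<^sup>2) powr (p / 2)"
          using IN n_nn p by (intro powr_mono2) auto
        then show "(\<integral>t. n t powr (p / 2) \<partial>time_meas T) \<le> ((1 + T) * B\<^sup>2) powr (p / 2) * T powr (1 - p / 2)"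
          using hold(2) by (meson mult_right_mono order_trans powr_ge_zero)
      qed (use W n_nn in auto)
      also have "\<dots> = R"
      proof -
        have 1: "((1 + T) * B\<^sup>2) powr (p / 2) = (1 + T) powr (p / 2) * B powr p"
          using B(1) \<open>T > 0\<close> by (simp add: powr_mult power2_powr)
        have 2: "B powr (2 * p) = B powr p * B powr p"
          by (simp flip: powr_add)
        show ?thesis unfolding R_def K_def 1 2 by (simp only: mult_ac)
      qed
      finally show "(\<integral>t. W * S powr (p / 2) * n t powr (p / 2) \<partial>time_meas T) \<le> R" .
    qed
    finally have le: "(\<integral>\<^sup>+z. ennreal (\<bar>case z of (t, x) \<Rightarrow> u t x\<bar> powr (2 * p)) \<partial>Q_meas T) \<le> ennreal R" .
    then have "integrable (Q_meas T) (\<lambda>z. \<bar>case z of (t, x) \<Rightarrow> u t x\<bar> powr (2 * p))"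
      by (intro integrableI_bounded meas) (auto intro: le_less_trans)
    moreover have "(\<integral>z. \<bar>case z of (t, x) \<Rightarrow> u t x\<bar> powr (2 * p) \<partial>Q_meas T) \<le> R"
      using le R by (intro integral_real_bounded) auto
    ultimately show ?thesis
      using umeas B(1) unfolding R_def B_def by blast
  qed
  show ?thesis
  \<comment> \<open>The constant is the \<open>2 * p\<close>-th root of \<open>K\<close>, which
    depends on \<open>a\<close>, \<open>p\<close> and \<open>T\<close> but not on
    \<open>u\<close>.\<close>
  proof (intro conjI ballI exI[of _ "K powr (1 / (2 * p))"])
    fix u assume u: "u \<in> energy_space a T"
    show "(\<lambda>(t, x). u t x) \<in> Lp_space (Q_meas T) (2 * p)"
      using main[OF u] unfolding Lp_space_def by blast
    have "Lp_norm (Q_meas T) (2 * p) (\<lambda>(t, x). u t x)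
        \<le> (K * T powr (1 - p / 2) * (B_norm a T u) powr (2 * p)) powr (1 / (2 * p))"
      unfolding Lp_norm_def using main[OF u] p by (intro powr_mono2) auto
    also have "\<dots> = K powr (1 / (2 * p)) * T powr (1 / (2 * p) * (1 - p / 2)) * B_norm a T u"
      using main[OF u] p K by (simp add: powr_mult powr_powr mult.commute)
    finally show "Lp_norm (Q_meas T) (2 * p) (\<lambda>(t, x). u t x)
        \<le> K powr (1 / (2 * p)) * T powr (1 / (2 * p) * (1 - p / 2)) * B_norm a T u" .
  qed (use K in simp)
qed

end
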